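(* There is an isomorphism of right $\mathsf{PlanEq}$-modules $\mathsf{Perm}\cong\overline{\mathsf{Ham}}\circ\mathsf{PlanEq}$; that is, $\mathsf{Perm}$ is the free right $\mathsf{PlanEq}$-module generated by $\overline{\mathsf{Ham}}$.
   Context: Graphs are finite, simple, undirected; a tube is a nonempty vertex set inducing a connected subgraph; $\Gamma/G$ contracts the tube $G$ to a vertex $\{G\}$; for a partition $I$ of $V_\Gamma$ into tubes, $\Gamma/I$ has the blocks as vertices, adjacent iff their union is a tube. $\overline{\Gamma}$ is the complement graph. Over a field $\mathsf{k}$, all collections are indexed by nonempty connected graphs and functorial in isomorphisms. For collections $\mathcal{V},\mathcal{P}$: $(\mathcal{V}\circ\mathcal{P})(\Gamma)=\bigoplus_{I}\mathcal{V}(\Gamma/I)\otimes\bigotimes_{G\in I}\mathcal{P}(\Gamma|_G)$; when $\mathcal{P}$ is a contractad this is the free right $\mathcal{P}$-module on $\mathcal{V}$. $\mathsf{Perm}(\Gamma)$ has basis all orderings $(v_1,\dots,v_n)$ of $V_\Gamma$, with contractad structure given by substitution $(u_1,\dots,\{G\},\dots,u_k)\circ^\Gamma_G(w_1,\dots,w_m)=(u_1,\dots,w_1,\dots,w_m,\dots,u_k)$. $\mathsf{PlanEq}(\Gamma)\subseteq\mathsf{Perm}(\Gamma)$ is spanned by the orderings that are left-to-right leaf sequences of $\Gamma$-admissible planar binary trees (planar rooted trees, internal vertices with two children, leaves labelled bijectively by $V_\Gamma$, leaf set below each vertex a tube); it is a subcontractad, and $\mathsf{Perm}$ is a right $\mathsf{PlanEq}$-module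 by restriction. $\overline{\mathsf{Ham}}(\Gamma)$ is the vector space with basis the directed Hamiltonian paths of $\overline{\Gamma}$ (orderings of $V_\Gamma$ in which no two consecutive vertices are adjacent in $\Gamma$). *)

theory Defs
  imports
    "Graph_Theory.Graph_Theory"
    "HOL-Library.FSet"
    "HOL-Library.FuncSet"
    "HOL-Library.Disjoint_Sets"
    "HOL-Library.Poly_Mapping"
    "HOL-Combinatorics.Multiset_Permutations"
begin

section \<open>Graphs, tubes and contractions\<close>

text \<open>
  A vertex universe containing an arbitrary type and closed under forming the vertex \<open>{G}\<close>
  obtained by contracting a finite vertex set \<open>G\<close>.  Thus a graph and all its iterated
  contractions have vertices in one type.
\<close>

datatype 'a vertex = Vertex 'a | Contracted "'a vertex fset"

definition block :: "'a vertex set \<Rightarrow> 'a vertex" where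
  "block G = Contracted (Abs_fset G)"

fun members :: "'a vertex \<Rightarrow> 'a vertex set" where
  "members (Vertex a) = {}"
| "members (Contracted A) = fset A"

lemma members_block [simp]: "finite G \<Longrightarrow> members (block G) = G"
  by (simp add: block_def Abs_fset_inverse)

type_synonym 'a vgraph = "'a vertex pair_pre_digraph"

text \<open>
  Finite simple undirected graphs are the pair graphs of the library (symmetric loop-free finite
  arc relations); its notion of connectedness excludes the empty graph.
\<close>

definition connected_graph :: "'a vgraph \<Rightarrow> bool" where
  "connected_graph \<Gamma> \<longleftrightarrow> pair_graph \<Gamma> \<and> Digraph_Component.connected (with_proj \<Gamma>)"

definition induced :: "'a vgraph \<Rightarrow> 'a vertex set \<Rightarrow> 'a vgraph" where
  "induced \<Gamma> S = \<lparr>pverts = S, parcs = parcs \<Gamma> \<inter> S \<times> S\<rparr>"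

lemma with_proj_induced: "with_proj (induced \<Gamma> S) = with_proj \<Gamma> \<restriction> S"
  by (auto simp: induced_def with_proj_def induce_subgraph_def)

definition tube :: "'a vgraph \<Rightarrow> 'a vertex set \<Rightarrow> bool" where
  "tube \<Gamma> S \<longleftrightarrow> S \<subseteq> pverts \<Gamma> \<and> Digraph_Component.connected (with_proj (induced \<Gamma> S))"

definition tube_partition :: "'a vgraph \<Rightarrow> 'a vertex set set \<Rightarrow> bool" where
  "tube_partition \<Gamma> I \<longleftrightarrow> partition_on (pverts \<Gamma>) I \<and> (\<forall>G\<in>I. tube \<Gamma> G)"

definition quotient :: "'a vgraph \<Rightarrow> 'a vertex set set \<Rightarrow> 'a vgraph" where
  "quotient \<Gamma> I =
     \<lparr>pverts = block ` I,
      parcs = {(block G, block H) | G H. G \<in> I \<and> H \<in> I \<and> G \<noteq> H \<and> tube \<Gamma> (G \<union> H)}\<rparr>"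

definition complement_graph :: "'a vgraph \<Rightarrow> 'a vgraph" where
  "complement_graph \<Gamma> =
     \<lparr>pverts = pverts \<Gamma>,
      parcs = {(u, v). u \<in> pverts \<Gamma> \<and> v \<in> pverts \<Gamma> \<and> u \<noteq> v \<and> (u, v) \<notin> parcs \<Gamma>}\<rparr>"

text \<open>
  The isomorphisms out of \<open>\<Gamma>\<close> are the maps \<open>f\<close> injective on its vertices; the codomain is
  the image graph.
\<close>

definition image_graph :: "('a vertex \<Rightarrow> 'a vertex) \<Rightarrow> 'a vgraph \<Rightarrow> 'a vgraph" where
  "image_graph f \<Gamma> = \<lparr>pverts = f ` pverts \<Gamma>, parcs = map_prod f f ` parcs \<Gamma>\<rparr>"


section \<open>Collections, contractads and right modules\<close>

text \<open>
  All collections needed here come with bases that are permuted by graph isomorphisms and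
  preserved by the structure maps.  A collection is therefore given by its bases, with
  \<open>\<Gamma> \<mapsto> k[basis C \<Gamma>]\<close> being the collection of vector spaces.  As
  \<open>k[\<Squnion>\<^sub>i A\<^sub>i] = \<Oplus>\<^sub>i k[A\<^sub>i]\<close> and \<open>k[\<Prod>\<^sub>i A\<^sub>i] = \<Otimes>\<^sub>i k[A\<^sub>i]\<close> (finite products), the operation
  \<open>\<circ>\<close> and the contractad and module axioms can be expressed on bases; morphisms are arbitrary
  linear maps and are treated in the next section.
\<close>

record ('a, 'b) collection =
  basis :: "'a vgraph \<Rightarrow> 'b set"
  relabel :: "'a vgraph \<Rightarrow> ('a vertex \<Rightarrow> 'a vertex) \<Rightarrow> 'b \<Rightarrow> 'b"

definition is_collection :: "('a, 'b, 'z) collection_scheme \<Rightarrow> bool" where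
  "is_collection C \<longleftrightarrow> (\<forall>\<Gamma>. connected_graph \<Gamma> \<longrightarrow>
     (\<forall>x\<in>basis C \<Gamma>. relabel C \<Gamma> id x = x) \<and>
     (\<forall>f. inj_on f (pverts \<Gamma>) \<longrightarrow> (\<forall>x\<in>basis C \<Gamma>.
        relabel C \<Gamma> f x \<in> basis C (image_graph f \<Gamma>) \<and>
        (\<forall>g. (\<forall>v\<in>pverts \<Gamma>. f v = g v) \<longrightarrow> relabel C \<Gamma> f x = relabel C \<Gamma> g x) \<and>
        (\<forall>g. inj_on g (f ` pverts \<Gamma>) \<longrightarrow>
           relabel C (image_graph f \<Gamma>) g (relabel C \<Gamma> f x) = relabel C \<Gamma> (g \<circ> f) x))))"

text \<open>
  A basis element \<open>(I, x, p)\<close> of \<open>(V \<circ> P)(\<Gamma>)\<close> stands for the pure tensor of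
  \<open>x \<in> V(\<Gamma>/I)\<close> with the \<open>p G \<in> P(\<Gamma>|\<^sub>G)\<close>, \<open>G \<in> I\<close>.
\<close>

type_synonym ('a, 'b, 'c) composite_elt =
  "'a vertex set set \<times> 'b \<times> ('a vertex set \<Rightarrow> 'c)"

definition composite ::
  "('a, 'b, 'y) collection_scheme \<Rightarrow> ('a, 'c, 'z) collection_scheme \<Rightarrow>
   ('a, ('a, 'b, 'c) composite_elt) collection" where
  "composite V P =
     \<lparr>basis = (\<lambda>\<Gamma>. {(I, x, p). tube_partition \<Gamma> I \<and> x \<in> basis V (quotient \<Gamma> I) \<and>
                       p \<in> (\<Pi>\<^sub>E G\<in>I. basis P (induced \<Gamma> G))}),
      relabel = (\<lambda>\<Gamma> f (I, x, p).
        ((`) f ` I,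
         relabel V (quotient \<Gamma> I) (\<lambda>b. block (f ` members b)) x,
         \<lambda>H \<in> (`) f ` I. let G = {v \<in> pverts \<Gamma>. f v \<in> H} in relabel P (induced \<Gamma> G) f (p G)))\<rparr>"

text \<open>
  \<open>gamma\<close> is the structure map \<open>M \<circ> P \<rightarrow> M\<close>.  A contractad is in particular a right module over
  itself, with \<open>gamma\<close> its composition \<open>P \<circ> P \<rightarrow> P\<close>; \<open>unit_elt v\<close> is its unit in the component of
  the one-vertex graph on \<open>v\<close>.
\<close>

record ('a, 'm, 'b) right_module = "('a, 'm) collection" +
  gamma :: "'a vgraph \<Rightarrow> ('a, 'm, 'b) composite_elt \<Rightarrow> 'm"

record ('a, 'b) contractad = "('a, 'b, 'b) right_module" +
  unit_elt :: "'a vertex \<Rightarrow> 'b"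

text \<open>
  The structure map \<open>(V \<circ> P) \<circ> P \<cong> V \<circ> (P \<circ> P) \<rightarrow> V \<circ> P\<close> of the free right module.  Given a
  partition \<open>J\<close> of \<open>\<Gamma>\<close> and a partition \<open>I\<close> of \<open>\<Gamma>/J\<close>, every \<open>B \<in> I\<close> consists of blocks of \<open>J\<close>, whose
  union is a block \<open>K\<close> of the partition \<open>flatten I\<close> of \<open>\<Gamma>\<close>.  Then \<open>(\<Gamma>/J)/I\<close> is identified with
  \<open>\<Gamma>/(flatten I)\<close>, while \<open>(\<Gamma>/J)|\<^sub>B\<close> and \<open>(\<Gamma>|\<^sub>K)/(J|\<^sub>K)\<close> are equal.
\<close>

definition flatten :: "'a vertex set set \<Rightarrow> 'a vertex set set" where
  "flatten I = (\<lambda>B. \<Union>(members ` B)) ` I"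

definition flatten_vertex :: "'a vertex \<Rightarrow> 'a vertex" where
  "flatten_vertex b = block (\<Union>(members ` members b))"

definition free_gamma ::
  "('a, 'v, 'y) collection_scheme \<Rightarrow> ('a, 'b, 'z) contractad_scheme \<Rightarrow> 'a vgraph \<Rightarrow>
   ('a, ('a, 'v, 'b) composite_elt, 'b) composite_elt \<Rightarrow> ('a, 'v, 'b) composite_elt" where
  "free_gamma V P \<Gamma> = (\<lambda>(J, (I, x, p), q).
     (flatten I,
      relabel V (quotient (quotient \<Gamma> J) I) flatten_vertex x,
      \<lambda>K \<in> flatten I. let J' = {G \<in> J. G \<subseteq> K} in
         gamma P (induced \<Gamma> K) (J', p (block ` J'), restrict q J')))"

definition free_right_module ::
  "('a, 'v, 'y) collection_scheme \<Rightarrow> ('a, 'b, 'z) contractad_scheme \<Rightarrow>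
   ('a, ('a, 'v, 'b) composite_elt, 'b) right_module" where
  "free_right_module V P =
     \<lparr>basis = basis (composite V P), relabel = relabel (composite V P), gamma = free_gamma V P\<rparr>"

text \<open>
  The axioms: equivariance of \<open>gamma\<close>, associativity
  \<open>gamma (gamma (x; p); q) = gamma (x; gamma (p; q))\<close>, and unitality.
\<close>

definition module_axioms ::
  "('a, 'b, 'z) contractad_scheme \<Rightarrow> ('a, 'm, 'b, 'y) right_module_scheme \<Rightarrow> bool" where
  "module_axioms P M \<longleftrightarrow> is_collection M \<and>
     (\<forall>\<Gamma>. connected_graph \<Gamma> \<longrightarrow>
        (\<forall>t\<in>basis (composite M P) \<Gamma>. gamma M \<Gamma> t \<in> basis M \<Gamma>) \<and>
        (\<forall>t\<in>basis (composite M P) \<Gamma>. \<forall>f. inj_on f (pverts \<Gamma>) \<longrightarrow>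
           relabel M \<Gamma> f (gamma M \<Gamma> t)
             = gamma M (image_graph f \<Gamma>) (relabel (composite M P) \<Gamma> f t)) \<and>
        (\<forall>J s q. (J, s, q) \<in> basis (composite (composite M P) P) \<Gamma> \<longrightarrow>
           gamma M \<Gamma> (J, gamma M (quotient \<Gamma> J) s, q) = gamma M \<Gamma> (free_gamma M P \<Gamma> (J, s, q))) \<and>
        (let I = (\<lambda>v. {v}) ` pverts \<Gamma> in
           \<forall>x\<in>basis M (quotient \<Gamma> I).
             gamma M \<Gamma> (I, x, \<lambda>S\<in>I. unit_elt P (the_elem S))
               = relabel M (quotient \<Gamma> I) (\<lambda>b. the_elem (members b)) x))"

definition is_contractad :: "('a, 'b, 'z) contractad_scheme \<Rightarrow> bool" where
  "is_contractad P \<longleftrightarrow> module_axioms P P \<and>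
     (\<forall>v. unit_elt P v \<in> basis P \<lparr>pverts = {v}, parcs = {}\<rparr> \<and>
        (\<forall>f. relabel P \<lparr>pverts = {v}, parcs = {}\<rparr> f (unit_elt P v) = unit_elt P (f v))) \<and>
     (\<forall>\<Gamma>. connected_graph \<Gamma> \<longrightarrow> (\<forall>y\<in>basis P \<Gamma>.
        gamma P \<Gamma> ({pverts \<Gamma>}, unit_elt P (block (pverts \<Gamma>)), \<lambda>G\<in>{pverts \<Gamma>}. y) = y))"

definition is_right_module ::
  "('a, 'b, 'z) contractad_scheme \<Rightarrow> ('a, 'm, 'b, 'y) right_module_scheme \<Rightarrow> bool" where
  "is_right_module P M \<longleftrightarrow> is_contractad P \<and> module_axioms P M"


section \<open>Linearization and isomorphisms of right modules\<close>

definition free_space :: "'b set \<Rightarrow> ('b \<Rightarrow>\<^sub>0 'k::field) set" where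
  "free_space B = {u. Poly_Mapping.keys u \<subseteq> B}"

definition scale :: "'k::field \<Rightarrow> ('b \<Rightarrow>\<^sub>0 'k) \<Rightarrow> ('b \<Rightarrow>\<^sub>0 'k)" where
  "scale c u = Poly_Mapping.map ((*) c) u"

definition extend_linearly :: "('b \<Rightarrow> ('c \<Rightarrow>\<^sub>0 'k)) \<Rightarrow> ('b \<Rightarrow>\<^sub>0 'k) \<Rightarrow> ('c \<Rightarrow>\<^sub>0 'k::field)" where
  "extend_linearly h u = (\<Sum>b\<in>Poly_Mapping.keys u. scale (Poly_Mapping.lookup u b) (h b))"

definition linearize :: "('b \<Rightarrow> 'c) \<Rightarrow> ('b \<Rightarrow>\<^sub>0 'k) \<Rightarrow> ('c \<Rightarrow>\<^sub>0 'k::field)" where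
  "linearize h = extend_linearly (\<lambda>b. Poly_Mapping.single (h b) 1)"

definition linear_iso ::
  "('b \<Rightarrow>\<^sub>0 'k) set \<Rightarrow> ('c \<Rightarrow>\<^sub>0 'k) set \<Rightarrow> (('b \<Rightarrow>\<^sub>0 'k) \<Rightarrow> ('c \<Rightarrow>\<^sub>0 'k::field)) \<Rightarrow> bool" where
  "linear_iso U W \<phi> \<longleftrightarrow> bij_betw \<phi> U W \<and>
     (\<forall>u\<in>U. \<forall>u'\<in>U. \<phi> (u + u') = \<phi> u + \<phi> u') \<and>
     (\<forall>c. \<forall>u\<in>U. \<phi> (scale c u) = scale c (\<phi> u))"

text \<open>The map \<open>\<phi> \<circ> P : M \<circ> P \<rightarrow> N \<circ> P\<close> induced by a family of linear maps \<open>\<phi> : M \<rightarrow> N\<close>.\<close>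

definition compose_morphism ::
  "('a vgraph \<Rightarrow> ('m \<Rightarrow>\<^sub>0 'k) \<Rightarrow> ('n \<Rightarrow>\<^sub>0 'k)) \<Rightarrow> 'a vgraph \<Rightarrow>
   (('a, 'm, 'b) composite_elt \<Rightarrow>\<^sub>0 'k) \<Rightarrow> (('a, 'n, 'b) composite_elt \<Rightarrow>\<^sub>0 'k::field)" where
  "compose_morphism \<phi> \<Gamma> = extend_linearly (\<lambda>(I, x, p).
     linearize (\<lambda>y. (I, y, p)) (\<phi> (quotient \<Gamma> I) (Poly_Mapping.single x 1)))"

definition right_module_iso ::
  "('a, 'b, 'z) contractad_scheme \<Rightarrow> ('a, 'm, 'b, 'x) right_module_scheme \<Rightarrow>
   ('a, 'n, 'b, 'y) right_module_scheme \<Rightarrow>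
   ('a vgraph \<Rightarrow> ('m \<Rightarrow>\<^sub>0 'k) \<Rightarrow> ('n \<Rightarrow>\<^sub>0 'k::field)) \<Rightarrow> bool" where
  "right_module_iso P M N \<phi> \<longleftrightarrow> is_right_module P M \<and> is_right_module P N \<and>
     (\<forall>\<Gamma>. connected_graph \<Gamma> \<longrightarrow>
        linear_iso (free_space (basis M \<Gamma>)) (free_space (basis N \<Gamma>)) (\<phi> \<Gamma>) \<and>
        (\<forall>f u. inj_on f (pverts \<Gamma>) \<and> u \<in> free_space (basis M \<Gamma>) \<longrightarrow>
           \<phi> (image_graph f \<Gamma>) (linearize (relabel M \<Gamma> f) u)
             = linearize (relabel N \<Gamma> f) (\<phi> \<Gamma> u)) \<and>
        (\<forall>z\<in>free_space (basis (composite M P) \<Gamma>).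
           \<phi> \<Gamma> (linearize (gamma M \<Gamma>) z)
             = linearize (gamma N \<Gamma>) (compose_morphism \<phi> \<Gamma> z)))"


section \<open>The contractads Perm and PlanEq, and the collection Ham\<close>

definition Perm :: "('a, 'a vertex list) contractad" where
  "Perm =
     \<lparr>basis = (\<lambda>\<Gamma>. permutations_of_set (pverts \<Gamma>)),
      relabel = (\<lambda>\<Gamma> f. map f),
      gamma = (\<lambda>\<Gamma> (I, u, w). concat (map (\<lambda>b. w (members b)) u)),
      unit_elt = (\<lambda>v. [v])\<rparr>"

text \<open>
  The structure map of \<open>Perm\<close> substitutes orderings for all vertices of \<open>\<Gamma>/I\<close> simultaneously.
  For \<open>\<Gamma>/G\<close>, where only one block \<open>G\<close> is nontrivial, it is the partial composition \<open>\<circ>\<^sub>G\<close>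
  (a vertex \<open>v \<notin> G\<close> corresponding to the block \<open>{v}\<close>).
\<close>

lemma gamma_Perm_partial:
  assumes "finite G" "set us \<inter> G = {}" "set us' \<inter> G = {}"
  shows "gamma Perm \<Gamma>
           (insert G ((\<lambda>v. {v}) ` (pverts \<Gamma> - G)),
            map (\<lambda>v. block {v}) us @ [block G] @ map (\<lambda>v. block {v}) us',
            \<lambda>S. if S = G then ws else [the_elem S])
         = us @ ws @ us'"
proof -
  have "concat (map (\<lambda>v. if {v} = G then ws else [the_elem {v}]) xs) = xs" if "set xs \<inter> G = {}" for xs
    using that by (induction xs) auto
  then show ?thesis
    using assms by (simp add: Perm_def comp_def)
qed

datatype 'v planar_binary_tree =
    Leaf 'v
  | Node "'v planar_binary_tree" "'v planar_binary_tree"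

fun leaves :: "'v planar_binary_tree \<Rightarrow> 'v list" where
  "leaves (Leaf v) = [v]"
| "leaves (Node l r) = leaves l @ leaves r"

fun subtrees :: "'v planar_binary_tree \<Rightarrow> 'v planar_binary_tree set" where
  "subtrees (Leaf v) = {Leaf v}"
| "subtrees (Node l r) = insert (Node l r) (subtrees l \<union> subtrees r)"

definition admissible :: "'a vgraph \<Rightarrow> 'a vertex planar_binary_tree \<Rightarrow> bool" where
  "admissible \<Gamma> t \<longleftrightarrow> distinct (leaves t) \<and> set (leaves t) = pverts \<Gamma> \<and>
     (\<forall>s\<in>subtrees t. tube \<Gamma> (set (leaves s)))"

definition PlanEq :: "('a, 'a vertex list) contractad" where
  "PlanEq = Perm\<lparr>basis := \<lambda>\<Gamma>. {leaves t | t. admissible \<Gamma> t}\<rparr>"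

definition Ham :: "('a, 'a vertex list) collection" where
  "Ham =
     \<lparr>basis = (\<lambda>\<Gamma>. {u \<in> permutations_of_set (pverts \<Gamma>).
                     successively (\<lambda>v w. (v, w) \<in> parcs (complement_graph \<Gamma>)) u}),
      relabel = (\<lambda>\<Gamma> f. map f)\<rparr>"

end

theory Submission
  imports Defs
begin

text \<open>
  Call two consecutive blocks of an ordering of the vertices mergeable if their union is a tube.
  Merging the singleton blocks as long as possible cuts the ordering into blocks that are leaf
  sequences of admissible trees and such that no two consecutive ones span a tube; the latter says
  that the blocks form a Hamiltonian path in the complement of the contracted graph.  The result
  does not depend on the choices: an admissible tree whose leaf sequence met two consecutive such
  blocks would have a node whose two subtrees lie in different blocks, and the edge between these
  subtrees would make the blocks mergeable.  So substitution
  \<open>Ham \<circ> PlanEq \<rightarrow> Perm \<circ> PlanEq \<rightarrow> Perm\<close> is bijective on bases, and by associativity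
  in \<open>Perm\<close> it is a morphism of modules.
\<close>

section \<open>Tubes\<close>

text \<open>Everything is decided on bases; the linear isomorphism is the linearization of the
  inverse of the substitution bijection. The obstacle is the module structure of the free module,
  whose axioms involve iterated contractions. The module equations are therefore computed only once,
  for \<open>Perm\<close> over \<open>PlanEq\<close>, where they compare concatenated words.
  \<open>PlanEq\<close>, by inclusion, and the free module, by the substitution map
  \<open>gamma Perm\<close>, inherit them through \<open>module_axioms_transport\<close>, which
  needs the map to be injective; so bijectivity is proved before the free module is known to be a
  module. What remains is that structure maps land in the right bases. This rests on two
  identifications: contracting twice is contracting the flattened partition up to
  \<open>flatten_vertex\<close>, and contraction commutes with restriction to a union of blocks.
  Both use \<open>tube_quotient_iff\<close>. Connectedness is handled by cuts instead of paths, as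
  cuts pass easily through restriction, isomorphism and contraction.\<close>

lemma pair_graph_iff:
  "pair_graph \<Gamma> \<longleftrightarrow> finite (pverts \<Gamma>) \<and> parcs \<Gamma> \<subseteq> pverts \<Gamma> \<times> pverts \<Gamma> \<and> sym (parcs \<Gamma>) \<and>
     irrefl (parcs \<Gamma>)"
proof
  assume "pair_graph \<Gamma>"
  then interpret pair_graph \<Gamma> .
  show "finite (pverts \<Gamma>) \<and> parcs \<Gamma> \<subseteq> pverts \<Gamma> \<times> pverts \<Gamma> \<and> sym (parcs \<Gamma>) \<and> irrefl (parcs \<Gamma>)"
    using pair_finite_verts arc_fst_in_verts arc_snd_in_verts pair_sym_arcs pair_no_loops
    by (fastforce simp: symmetric_def irrefl_def)
next
  assume *: "finite (pverts \<Gamma>) \<and> parcs \<Gamma> \<subseteq> pverts \<Gamma> \<times> pverts \<Gamma> \<and> sym (parcs \<Gamma>) \<and> irrefl (parcs \<Gamma>)"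
  then have "finite (parcs \<Gamma>)"
    by (meson finite_SigmaI finite_subset)
  then show "pair_graph \<Gamma>"
    using * by unfold_locales (auto simp: symmetric_def irrefl_def)
qed

text \<open>Reachability cannot leave a side of a cut without arcs; conversely, the vertices
  reachable from \<open>u\<close> and the remaining ones form a cut without arcs. Symmetry makes
  \<open>mk_symmetric\<close> the identity on arcs.\<close>

lemma connected_with_proj_iff:
  assumes "sym (parcs \<Gamma>)"
  shows "Digraph_Component.connected (with_proj \<Gamma>) \<longleftrightarrow> pverts \<Gamma> \<noteq> {} \<and>
    (\<forall>A B. A \<union> B = pverts \<Gamma> \<and> A \<inter> B = {} \<and> A \<noteq> {} \<and> B \<noteq> {} \<longrightarrow> (\<exists>a\<in>A. \<exists>b\<in>B. (a, b) \<in> parcs \<Gamma>))"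
    (is "?L \<longleftrightarrow> ?R")
proof -
  let ?V = "pverts \<Gamma>"
  have "parcs (mk_symmetric \<Gamma>) = parcs \<Gamma>"
    using assms by (auto simp: parcs_mk_symmetric sym_def)
  then have L: "?L \<longleftrightarrow> ?V \<noteq> {} \<and> (\<forall>u\<in>?V. \<forall>v\<in>?V. (u, v) \<in> rtrancl_on ?V (parcs \<Gamma>))"
    by (simp add: connected_def strongly_connected_def reachable_def)
  show ?thesis
  proof
    assume l: ?L
    have "\<exists>a\<in>A. \<exists>b\<in>B. (a, b) \<in> parcs \<Gamma>"
      if cut: "A \<union> B = ?V" "A \<inter> B = {}" "A \<noteq> {}" "B \<noteq> {}" for A B
    proof (rule ccontr)
      assume no: "\<not> ?thesis"
      obtain a b where ab: "a \<in> A" "b \<in> B" using cut by auto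
      then have "(a, b) \<in> rtrancl_on ?V (parcs \<Gamma>)" using l L cut by blast
      then have "b \<in> A" by (induction rule: rtrancl_on_induct) (use no cut ab in blast)+
      then show False using ab cut by auto
    qed
    then show ?R using l L by blast
  next
    assume R: ?R
    have "(u, v) \<in> rtrancl_on ?V (parcs \<Gamma>)" if "u \<in> ?V" "v \<in> ?V" for u v
    proof (rule ccontr)
      assume "\<not> ?thesis"
      \<comment> \<open>All that is reachable from \<open>u\<close>; an arc leaving this set would
        enlarge it.\<close>
      define A where "A = {v \<in> ?V. (u, v) \<in> rtrancl_on ?V (parcs \<Gamma>)}"
      have "A \<union> (?V - A) = ?V" "A \<noteq> {}" "?V - A \<noteq> {}"
        using that \<open>\<not> _\<close> by (auto simp: A_def)
      then obtain a b where "a \<in> A" "b \<in> ?V - A" "(a, b) \<in> parcs \<Gamma>"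
        using R by (metis Diff_disjoint)
      then show False by (auto simp: A_def intro: rtrancl_on_into_rtrancl_on)
    qed
    then show ?L using L R by blast
  qed
qed

text \<open>An arc between two parts of \<open>S\<close> lies in \<open>S \<times> S\<close> anyway,
  so the cut criterion for the induced subgraph can be stated with the arcs of the whole
  graph.\<close>

lemma tube_iff:
  assumes "pair_graph \<Gamma>"
  shows "tube \<Gamma> S \<longleftrightarrow> S \<subseteq> pverts \<Gamma> \<and> S \<noteq> {} \<and>
    (\<forall>A B. A \<union> B = S \<and> A \<inter> B = {} \<and> A \<noteq> {} \<and> B \<noteq> {} \<longrightarrow> (\<exists>a\<in>A. \<exists>b\<in>B. (a, b) \<in> parcs \<Gamma>))"
proof -
  have sym: "sym (parcs (induced \<Gamma> S))"
    using assms by (auto simp: pair_graph_iff induced_def sym_def)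
  have "(\<exists>a\<in>A. \<exists>b\<in>B. (a, b) \<in> parcs \<Gamma> \<inter> S \<times> S) \<longleftrightarrow> (\<exists>a\<in>A. \<exists>b\<in>B. (a, b) \<in> parcs \<Gamma>)"
    if "A \<union> B = S" for A B
    using that by auto
  then show ?thesis
    unfolding tube_def connected_with_proj_iff[OF sym] by (auto simp: induced_def)
qed

lemma tubeD: "tube \<Gamma> S \<Longrightarrow> S \<subseteq> pverts \<Gamma> \<and> S \<noteq> {}"
  by (auto simp: tube_def induced_def connected_def strongly_connected_def)

lemma tube_cut:
  assumes "pair_graph \<Gamma>" "tube \<Gamma> S" "A \<union> B = S" "A \<inter> B = {}" "A \<noteq> {}" "B \<noteq> {}"
  obtains a b where "a \<in> A" "b \<in> B" "(a, b) \<in> parcs \<Gamma>"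
  using assms tube_iff by metis

lemma connected_graph_iff: "connected_graph \<Gamma> \<longleftrightarrow> pair_graph \<Gamma> \<and> tube \<Gamma> (pverts \<Gamma>)"
proof -
  have "induced \<Gamma> (pverts \<Gamma>) = \<Gamma>" if "pair_graph \<Gamma>"
    using that unfolding pair_graph_iff induced_def
    by (intro pair_pre_digraph.equality) auto
  then show ?thesis by (auto simp: connected_graph_def tube_def)
qed

lemma connected_graphD: "connected_graph \<Gamma> \<Longrightarrow> pair_graph \<Gamma>"
  by (simp add: connected_graph_def)

lemma tube_singleton: "pair_graph \<Gamma> \<Longrightarrow> v \<in> pverts \<Gamma> \<Longrightarrow> tube \<Gamma> {v}"
  by (auto simp: tube_iff Un_singleton_iff)

text \<open>A cut that no arc crosses splits neither \<open>S\<close> nor \<open>T\<close>, so it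
  separates one from the other, and the given arc crosses it after all. This turns adjacency in a
  contraction into an arc of the original graph.\<close>

lemma tube_Un_iff:
  assumes "pair_graph \<Gamma>" "tube \<Gamma> S" "tube \<Gamma> T" "S \<inter> T = {}"
  shows "tube \<Gamma> (S \<union> T) \<longleftrightarrow> (\<exists>s\<in>S. \<exists>t\<in>T. (s, t) \<in> parcs \<Gamma>)"
proof
  assume "tube \<Gamma> (S \<union> T)"
  then show "\<exists>s\<in>S. \<exists>t\<in>T. (s, t) \<in> parcs \<Gamma>"
    using assms tubeD by (metis tube_cut)
next
  assume edge: "\<exists>s\<in>S. \<exists>t\<in>T. (s, t) \<in> parcs \<Gamma>"
  have within: "X \<subseteq> A \<or> X \<subseteq> B \<or> (\<exists>a\<in>A. \<exists>b\<in>B. (a, b) \<in> parcs \<Gamma>)"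
    if "tube \<Gamma> X" "X \<subseteq> A \<union> B" "A \<inter> B = {}" for X A B
  proof (rule ccontr)
    assume no: "\<not> ?thesis"
    then have "(X \<inter> A) \<union> (X \<inter> B) = X" "(X \<inter> A) \<inter> (X \<inter> B) = {}" "X \<inter> A \<noteq> {}" "X \<inter> B \<noteq> {}"
      using that by blast+
    then obtain a b where "a \<in> X \<inter> A" "b \<in> X \<inter> B" "(a, b) \<in> parcs \<Gamma>"
      using tube_cut[OF assms(1) \<open>tube \<Gamma> X\<close>] by metis
    then show False using no by blast
  qed
  have "\<exists>a\<in>A. \<exists>b\<in>B. (a, b) \<in> parcs \<Gamma>"
    if cut: "A \<union> B = S \<union> T" "A \<inter> B = {}" "A \<noteq> {}" "B \<noteq> {}" for A B
  proof (rule ccontr)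
    assume no: "\<not> ?thesis"
    have "S \<subseteq> A \<or> S \<subseteq> B" "T \<subseteq> A \<or> T \<subseteq> B"
      using within[of S A B] within[of T A B] no assms(2,3) cut(1,2) by simp_all
    then have "S \<subseteq> A \<and> T \<subseteq> B \<or> S \<subseteq> B \<and> T \<subseteq> A" using cut by blast
    \<comment> \<open>The arc is directed from \<open>S\<close> to \<open>T\<close>, while the cut
      may have \<open>T\<close> on its first side.\<close>
    moreover have "sym (parcs \<Gamma>)" using assms by (simp add: pair_graph_iff)
    ultimately show False using edge no by (meson subsetD symD)
  qed
  moreover have "S \<union> T \<subseteq> pverts \<Gamma>" "S \<union> T \<noteq> {}" using tubeD assms by blast+
  ultimately show "tube \<Gamma> (S \<union> T)" unfolding tube_iff[OF assms(1)] by blast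
qed

section \<open>Induced subgraphs and images under isomorphisms\<close>

lemma induced_simps [simp]:
  "pverts (induced \<Gamma> S) = S" "parcs (induced \<Gamma> S) = parcs \<Gamma> \<inter> S \<times> S"
  by (simp_all add: induced_def)

lemma pair_graph_induced: "pair_graph \<Gamma> \<Longrightarrow> S \<subseteq> pverts \<Gamma> \<Longrightarrow> pair_graph (induced \<Gamma> S)"
  by (auto simp: pair_graph_iff sym_def irrefl_def intro: finite_subset)

lemma induced_induced: "T \<subseteq> S \<Longrightarrow> induced (induced \<Gamma> S) T = induced \<Gamma> T"
  by (auto simp: induced_def)

lemma tube_induced: "S \<subseteq> pverts \<Gamma> \<Longrightarrow> tube (induced \<Gamma> S) T \<longleftrightarrow> tube \<Gamma> T \<and> T \<subseteq> S"
  by (auto simp: tube_def induced_induced)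

lemma connected_graph_induced: "pair_graph \<Gamma> \<Longrightarrow> tube \<Gamma> S \<Longrightarrow> connected_graph (induced \<Gamma> S)"
  by (simp add: connected_graph_iff pair_graph_induced tube_induced tubeD)

lemma image_graph_simps [simp]:
  "pverts (image_graph f \<Gamma>) = f ` pverts \<Gamma>" "parcs (image_graph f \<Gamma>) = map_prod f f ` parcs \<Gamma>"
  by (simp_all add: image_graph_def)

lemma image_graph_arc_iff:
  assumes "pair_graph \<Gamma>" "inj_on f (pverts \<Gamma>)" "u \<in> pverts \<Gamma>" "v \<in> pverts \<Gamma>"
  shows "(f u, f v) \<in> parcs (image_graph f \<Gamma>) \<longleftrightarrow> (u, v) \<in> parcs \<Gamma>"
proof
  assume "(f u, f v) \<in> parcs (image_graph f \<Gamma>)"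
  then obtain a b where ab: "(a, b) \<in> parcs \<Gamma>" "f u = f a" "f v = f b" by auto
  then have "a \<in> pverts \<Gamma>" "b \<in> pverts \<Gamma>" using assms(1) by (auto simp: pair_graph_iff)
  then show "(u, v) \<in> parcs \<Gamma>" using ab assms by (metis inj_onD)
qed force

lemma pair_graph_image:
  assumes "pair_graph \<Gamma>" "inj_on f (pverts \<Gamma>)"
  shows "pair_graph (image_graph f \<Gamma>)"
proof -
  have "irrefl (map_prod f f ` parcs \<Gamma>)"
  proof -
    have "f a \<noteq> f b" if "(a, b) \<in> parcs \<Gamma>" for a b
    proof -
      have "a \<in> pverts \<Gamma>" "b \<in> pverts \<Gamma>" "a \<noteq> b"
        using that assms(1) by (auto simp: pair_graph_iff irrefl_def)
      then show ?thesis using assms(2) by (meson inj_onD)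
    qed
    then show ?thesis by (auto simp: irrefl_def)
  qed
  moreover have "sym (map_prod f f ` parcs \<Gamma>)"
    using assms by (fastforce simp: pair_graph_iff sym_def)
  ultimately show ?thesis
    using assms by (auto simp: pair_graph_iff)
qed

text \<open>As \<open>f\<close> is injective, the cuts of the image are exactly the images of the
  cuts, and arcs between the parts correspond; so the cut criterion transfers in both
  directions.\<close>

lemma tube_image_iff:
  assumes \<Gamma>: "pair_graph \<Gamma>" and inj: "inj_on f (pverts \<Gamma>)" and S: "S \<subseteq> pverts \<Gamma>"
  shows "tube (image_graph f \<Gamma>) (f ` S) \<longleftrightarrow> tube \<Gamma> S"
proof -
  let ?cut = "\<lambda>\<Gamma> S A B. A \<union> B = S \<and> A \<inter> B = {} \<and> A \<noteq> {} \<and> B \<noteq> {} \<longrightarrow> (\<exists>a\<in>A. \<exists>b\<in>B. (a, b) \<in> parcs \<Gamma>)"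
  have cut: "?cut (image_graph f \<Gamma>) (f ` S) (f ` A) (f ` B) \<longleftrightarrow> ?cut \<Gamma> S A B" if AB: "A \<subseteq> S" "B \<subseteq> S" for A B
  proof -
    have "f ` A \<union> f ` B = f ` S \<longleftrightarrow> A \<union> B = S"
      unfolding image_Un[symmetric] using inj AB S by (intro inj_on_image_eq_iff) auto
    moreover have "f ` A \<inter> f ` B = {} \<longleftrightarrow> A \<inter> B = {}"
      using inj AB S by (metis image_Int_subset image_is_empty inj_on_image_Int subset_trans)
    moreover have "(\<exists>a\<in>f ` A. \<exists>b\<in>f ` B. (a, b) \<in> parcs (image_graph f \<Gamma>)) \<longleftrightarrow> (\<exists>a\<in>A. \<exists>b\<in>B. (a, b) \<in> parcs \<Gamma>)"
      using image_graph_arc_iff[OF \<Gamma> inj] AB S by (simp del: image_graph_simps) blast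
    ultimately show ?thesis by simp
  qed
  have "(\<forall>A B. ?cut (image_graph f \<Gamma>) (f ` S) A B) \<longleftrightarrow> (\<forall>A B. ?cut \<Gamma> S A B)"
  proof (intro iffI allI)
    fix A B assume "\<forall>A B. ?cut (image_graph f \<Gamma>) (f ` S) A B"
    then have *: "?cut (image_graph f \<Gamma>) (f ` S) (f ` A) (f ` B)" by (elim allE)
    show "?cut \<Gamma> S A B"
    proof (rule impI)
      assume **: "A \<union> B = S \<and> A \<inter> B = {} \<and> A \<noteq> {} \<and> B \<noteq> {}"
      then have "A \<subseteq> S" "B \<subseteq> S" by auto
      then show "\<exists>a\<in>A. \<exists>b\<in>B. (a, b) \<in> parcs \<Gamma>" 
        using * ** cut[of A B] by (simp del: image_graph_simps)
    qed
  next
    fix A B assume *: "\<forall>A B. ?cut \<Gamma> S A B"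
    show "?cut (image_graph f \<Gamma>) (f ` S) A B"
    proof (rule impI)
      assume **: "A \<union> B = f ` S \<and> A \<inter> B = {} \<and> A \<noteq> {} \<and> B \<noteq> {}"
      then have "A \<subseteq> f ` S" "B \<subseteq> f ` S" by auto
      then obtain A' B' where AB: "A = f ` A'" "A' \<subseteq> S" "B = f ` B'" "B' \<subseteq> S"
        by (meson subset_imageE)
      have "?cut \<Gamma> S A' B'" using * by (elim allE)
      then have "?cut (image_graph f \<Gamma>) (f ` S) A B" unfolding AB cut[OF AB(2,4)] .
      then show "\<exists>a\<in>A. \<exists>b\<in>B. (a, b) \<in> parcs (image_graph f \<Gamma>)" using ** by (rule mp)
    qed
  qed
  then show ?thesis
    using S unfolding tube_iff[OF \<Gamma>] tube_iff[OF pair_graph_image[OF \<Gamma> inj]]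
    by (simp add: image_mono del: image_graph_simps(2))
qed

lemma connected_graph_image:
  "connected_graph \<Gamma> \<Longrightarrow> inj_on f (pverts \<Gamma>) \<Longrightarrow> connected_graph (image_graph f \<Gamma>)"
  by (simp add: connected_graph_iff pair_graph_image tube_image_iff)

lemma induced_image:
  assumes "pair_graph \<Gamma>" "inj_on f (pverts \<Gamma>)" "S \<subseteq> pverts \<Gamma>"
  shows "induced (image_graph f \<Gamma>) (f ` S) = image_graph f (induced \<Gamma> S)"
proof -
  have "parcs (image_graph f \<Gamma>) \<inter> f ` S \<times> f ` S = map_prod f f ` (parcs \<Gamma> \<inter> S \<times> S)"
  proof (intro set_eqI iffI)
    fix e assume "e \<in> parcs (image_graph f \<Gamma>) \<inter> f ` S \<times> f ` S"
    then obtain u v where uv: "e = (f u, f v)" "u \<in> S" "v \<in> S" "(f u, f v) \<in> parcs (image_graph f \<Gamma>)"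
      by blast
    then have "(u, v) \<in> parcs \<Gamma>" using image_graph_arc_iff[OF assms(1,2)] assms(3) by blast
    then show "e \<in> map_prod f f ` (parcs \<Gamma> \<inter> S \<times> S)" using uv by force
  qed auto
  then show ?thesis by (simp add: induced_def image_graph_def)
qed

section \<open>Contractions\<close>

lemma block_inject: "finite G \<Longrightarrow> finite H \<Longrightarrow> block G = block H \<longleftrightarrow> G = H"
  by (metis members_block)

lemma tube_partitionD:
  assumes "pair_graph \<Gamma>" "tube_partition \<Gamma> I"
  shows "\<Union>I = pverts \<Gamma>" "finite I" "disjoint I" "{} \<notin> I"
    "\<And>G. G \<in> I \<Longrightarrow> tube \<Gamma> G" "\<And>G. G \<in> I \<Longrightarrow> finite G" "\<And>G. G \<in> I \<Longrightarrow> G \<subseteq> pverts \<Gamma>"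
    "\<And>G. G \<in> I \<Longrightarrow> G \<noteq> {}"
    "\<And>G H. G \<in> I \<Longrightarrow> H \<in> I \<Longrightarrow> G \<noteq> H \<Longrightarrow> G \<inter> H = {}"
proof -
  have fin: "finite (pverts \<Gamma>)" using assms by (simp add: pair_graph_iff)
  show 1: "\<Union>I = pverts \<Gamma>" and "disjoint I" and "{} \<notin> I" and "\<And>G. G \<in> I \<Longrightarrow> tube \<Gamma> G"
    using assms by (auto simp: tube_partition_def partition_on_def)
  then show "\<And>G H. G \<in> I \<Longrightarrow> H \<in> I \<Longrightarrow> G \<noteq> H \<Longrightarrow> G \<inter> H = {}" by (simp add: disjointD)
  show 2: "\<And>G. G \<in> I \<Longrightarrow> G \<subseteq> pverts \<Gamma>" using 1 by auto
  then show "\<And>G. G \<in> I \<Longrightarrow> finite G" using fin by (meson finite_subset)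
  show "\<And>G. G \<in> I \<Longrightarrow> G \<noteq> {}" using \<open>{} \<notin> I\<close> by auto
  show "finite I" using 1 fin by (simp add: finite_UnionD)
qed

lemma inj_on_block: "pair_graph \<Gamma> \<Longrightarrow> tube_partition \<Gamma> I \<Longrightarrow> inj_on block I"
  by (meson block_inject inj_onI tube_partitionD(6))

lemma quotient_simps [simp]:
  "pverts (quotient \<Gamma> I) = block ` I"
  "parcs (quotient \<Gamma> I) = {(block G, block H) | G H. G \<in> I \<and> H \<in> I \<and> G \<noteq> H \<and> tube \<Gamma> (G \<union> H)}"
  by (simp_all add: quotient_def)

lemma members_image_block: "(\<And>G. G \<in> B \<Longrightarrow> finite G) \<Longrightarrow> members ` block ` B = B"
  by (force simp: image_image)

lemma quotient_arc_iff:
  assumes "pair_graph \<Gamma>" "tube_partition \<Gamma> I" "G \<in> I" "H \<in> I"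
  shows "(block G, block H) \<in> parcs (quotient \<Gamma> I) \<longleftrightarrow> G \<noteq> H \<and> tube \<Gamma> (G \<union> H)"
  using tube_partitionD(6)[OF assms(1,2)] assms(3,4) by (auto simp: block_inject)

lemma quotient_arc_iff_edge:
  assumes "pair_graph \<Gamma>" "tube_partition \<Gamma> I" "G \<in> I" "H \<in> I"
  shows "(block G, block H) \<in> parcs (quotient \<Gamma> I) \<longleftrightarrow> G \<noteq> H \<and> (\<exists>g\<in>G. \<exists>h\<in>H. (g, h) \<in> parcs \<Gamma>)"
  unfolding quotient_arc_iff[OF assms]
  using tube_partitionD(5,9)[OF assms(1,2)] tube_Un_iff[OF assms(1)] assms(3,4) by metis

lemma pair_graph_quotient:
  assumes "pair_graph \<Gamma>" "tube_partition \<Gamma> I"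
  shows "pair_graph (quotient \<Gamma> I)"
proof -
  have "irrefl (parcs (quotient \<Gamma> I))"
  proof (unfold irrefl_def, intro allI notI)
    fix b assume "(b, b) \<in> parcs (quotient \<Gamma> I)"
    then obtain G H where "b = block G" "b = block H" "G \<in> I" "H \<in> I" "G \<noteq> H" by auto
    then show False using inj_on_block[OF assms] by (metis inj_onD)
  qed
  moreover have "sym (parcs (quotient \<Gamma> I))"
    unfolding sym_def quotient_simps by clarsimp (metis Un_commute)
  ultimately show ?thesis
    using tube_partitionD(2)[OF assms] by (auto simp: pair_graph_iff)
qed

text \<open>Forward: a cut of the union crossed by no arc cannot split a block, since each block is
  a tube; so it comes from a cut of the set of blocks, which has an arc. Backward: a cut of the set
  of blocks yields a cut of the union by taking unions. Iterated contraction and the grafting of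
  trees rest on this equivalence.\<close>

lemma tube_quotient_iff:
  assumes \<Gamma>: "pair_graph \<Gamma>" and I: "tube_partition \<Gamma> I" and B: "B \<subseteq> I"
  shows "tube (quotient \<Gamma> I) (block ` B) \<longleftrightarrow> tube \<Gamma> (\<Union>B)"
proof
  note I' = tube_partitionD[OF \<Gamma> I]
  assume l: "tube (quotient \<Gamma> I) (block ` B)"
  have "\<exists>a\<in>A. \<exists>c\<in>C. (a, c) \<in> parcs \<Gamma>"
    if cut: "A \<union> C = \<Union>B" "A \<inter> C = {}" "A \<noteq> {}" "C \<noteq> {}" for A C
  proof (rule ccontr)
    assume no: "\<not> ?thesis"
    have in_one: "G \<subseteq> A \<or> G \<subseteq> C" if "G \<in> B" for G
    proof (rule ccontr)
      assume "\<not> ?thesis"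
      moreover have "tube \<Gamma> G" using I'(5) B that by blast
      ultimately have "(G \<inter> A) \<union> (G \<inter> C) = G" "(G \<inter> A) \<inter> (G \<inter> C) = {}" "G \<inter> A \<noteq> {}" "G \<inter> C \<noteq> {}" "tube \<Gamma> G"
        using that cut by blast+
      then obtain a c where "a \<in> G \<inter> A" "c \<in> G \<inter> C" "(a, c) \<in> parcs \<Gamma>"
        using tube_cut[OF \<Gamma>] by metis
      then show False using no by auto
    qed
    let ?A = "{G \<in> B. G \<subseteq> A}" and ?C = "{G \<in> B. G \<subseteq> C}"
    have "?A \<union> ?C = B" using in_one by auto
    then have un: "block ` ?A \<union> block ` ?C = block ` B" by (simp add: image_Un[symmetric])
    have "?A \<inter> ?C = {}" using I'(8) B cut by blast
    then have int: "block ` ?A \<inter> block ` ?C = {}"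
      using inj_on_image_Int[OF inj_on_block[OF \<Gamma> I], of ?A ?C] B
      by (metis (no_types, lifting) image_empty mem_Collect_eq subsetD subsetI)
    have A: "block ` ?A \<noteq> {}"
    proof -
      obtain a G where "a \<in> A" "G \<in> B" "a \<in> G" using cut by blast
      then show ?thesis using in_one[of G] cut(2) by blast
    qed
    have C: "block ` ?C \<noteq> {}"
    proof -
      obtain c G where "c \<in> C" "G \<in> B" "c \<in> G" using cut by blast
      then show ?thesis using in_one[of G] cut(2) by blast
    qed
    obtain a c where ac: "a \<in> block ` ?A" "c \<in> block ` ?C" "(a, c) \<in> parcs (quotient \<Gamma> I)"
      by (rule tube_cut[OF pair_graph_quotient[OF \<Gamma> I] l un int A C])
    then obtain G H where GH: "G \<in> ?A" "H \<in> ?C" "(block G, block H) \<in> parcs (quotient \<Gamma> I)" by auto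
    then have "\<exists>g\<in>G. \<exists>h\<in>H. (g, h) \<in> parcs \<Gamma>"
      using quotient_arc_iff_edge[OF \<Gamma> I, of G H] B by auto
    then show False using GH no by blast
  qed
  moreover have "B \<noteq> {}" using l tubeD by auto
  then have "\<Union>B \<noteq> {}" using B I'(8) by blast
  moreover have "\<Union>B \<subseteq> pverts \<Gamma>" using B I'(1) by blast
  ultimately show "tube \<Gamma> (\<Union>B)" unfolding tube_iff[OF \<Gamma>] by blast
next
  note I' = tube_partitionD[OF \<Gamma> I]
  assume r: "tube \<Gamma> (\<Union>B)"
  have "\<exists>a\<in>A. \<exists>c\<in>C. (a, c) \<in> parcs (quotient \<Gamma> I)"
    if cut: "A \<union> C = block ` B" "A \<inter> C = {}" "A \<noteq> {}" "C \<noteq> {}" for A C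
  proof -
    have "A \<subseteq> block ` B" "C \<subseteq> block ` B" using cut(1) by auto
    then obtain A' C' where A': "A = block ` A'" "A' \<subseteq> B" and C': "C = block ` C'" "C' \<subseteq> B"
      by (metis subset_imageE)
    have "block ` (A' \<union> C') = block ` B" using cut A' C' by auto
    then have "A' \<union> C' = B"
      using inj_on_image_eq_iff[OF inj_on_block[OF \<Gamma> I]] A' C' B by (metis Un_least subset_trans)
    then have un: "\<Union>A' \<union> \<Union>C' = \<Union>B" by auto
    have disj: "A' \<inter> C' = {}" using cut A' C' by auto
    then have int: "\<Union>A' \<inter> \<Union>C' = {}" using I'(9) A' C' B by blast
    have "A' \<noteq> {}" "C' \<noteq> {}" using A' C' cut by auto
    then have ne: "\<Union>A' \<noteq> {}" "\<Union>C' \<noteq> {}" using I'(8) A' C' B by blast+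
    obtain a c where ac: "a \<in> \<Union>A'" "c \<in> \<Union>C'" "(a, c) \<in> parcs \<Gamma>"
      by (rule tube_cut[OF \<Gamma> r un int ne])
    then obtain G H where GH: "G \<in> A'" "a \<in> G" "H \<in> C'" "c \<in> H" by auto
    then have "(block G, block H) \<in> parcs (quotient \<Gamma> I)"
      using quotient_arc_iff_edge[OF \<Gamma> I, of G H] ac A' C' B disj by blast
    then show ?thesis using A' C' GH by blast
  qed
  moreover have "B \<noteq> {}" using r tubeD by auto
  ultimately show "tube (quotient \<Gamma> I) (block ` B)"
    using B unfolding tube_iff[OF pair_graph_quotient[OF \<Gamma> I]] quotient_simps(1) by blast
qed

lemma connected_graph_quotient:
  assumes "connected_graph \<Gamma>" "tube_partition \<Gamma> I"
  shows "connected_graph (quotient \<Gamma> I)"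
  using assms tube_quotient_iff[of \<Gamma> I I] tube_partitionD(1)[of \<Gamma> I]
  by (simp add: connected_graph_iff pair_graph_quotient)

section \<open>Contraction under isomorphisms, and contraction of single vertices\<close>

lemma image_graph_eqI:
  assumes "pair_graph \<Gamma>" "pair_graph \<Gamma>'" "g ` pverts \<Gamma> = pverts \<Gamma>'"
    and arcs: "\<And>u v. u \<in> pverts \<Gamma> \<Longrightarrow> v \<in> pverts \<Gamma> \<Longrightarrow> (g u, g v) \<in> parcs \<Gamma>' \<longleftrightarrow> (u, v) \<in> parcs \<Gamma>"
  shows "image_graph g \<Gamma> = \<Gamma>'"
proof -
  have sub: "parcs \<Gamma> \<subseteq> pverts \<Gamma> \<times> pverts \<Gamma>" "parcs \<Gamma>' \<subseteq> pverts \<Gamma>' \<times> pverts \<Gamma>'"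
    using assms(1,2) by (simp_all add: pair_graph_iff)
  have "map_prod g g ` parcs \<Gamma> = parcs \<Gamma>'"
  proof (intro set_eqI iffI)
    fix e assume "e \<in> parcs \<Gamma>'"
    moreover from this obtain u v where "e = (g u, g v)" "u \<in> pverts \<Gamma>" "v \<in> pverts \<Gamma>"
      using sub(2) assms(3) by blast
    ultimately show "e \<in> map_prod g g ` parcs \<Gamma>" using arcs by force
  qed (use sub(1) arcs in auto)
  then show ?thesis using assms(3) by (simp add: image_graph_def)
qed

lemma tube_partition_image:
  assumes \<Gamma>: "pair_graph \<Gamma>" and inj: "inj_on f (pverts \<Gamma>)" and I: "tube_partition \<Gamma> I"
  shows "tube_partition (image_graph f \<Gamma>) ((`) f ` I)"
proof -
  note I' = tube_partitionD[OF \<Gamma> I]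
  have "disjoint ((`) f ` I)"
  proof (rule disjointI)
    fix A B assume "A \<in> (`) f ` I" "B \<in> (`) f ` I" "A \<noteq> B"
    then obtain G H where GH: "A = f ` G" "B = f ` H" "G \<in> I" "H \<in> I" "G \<noteq> H" by auto
    then have "f ` G \<inter> f ` H = f ` (G \<inter> H)" using inj_on_image_Int[OF inj] I'(7) by metis
    then show "A \<inter> B = {}" using GH I'(9) by simp
  qed
  moreover have "\<Union>((`) f ` I) = pverts (image_graph f \<Gamma>)" using I'(1) by auto
  moreover have "{} \<notin> (`) f ` I" using I'(8) by auto
  moreover have "tube (image_graph f \<Gamma>) G" if "G \<in> (`) f ` I" for G
    using that tube_image_iff[OF \<Gamma> inj] I'(5,7) by auto
  ultimately show ?thesis by (auto simp: tube_partition_def partition_on_def)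
qed

lemma inj_on_image_block:
  assumes \<Gamma>: "pair_graph \<Gamma>" and inj: "inj_on f (pverts \<Gamma>)" and I: "tube_partition \<Gamma> I"
  shows "inj_on (\<lambda>b. block (f ` members b)) (block ` I)"
proof -
  note I' = tube_partitionD[OF \<Gamma> I]
  have "G = H" if "G \<in> I" "H \<in> I" "block (f ` G) = block (f ` H)" for G H
    using that I'(6,7) inj_on_image_eq_iff[OF inj] by (simp add: block_inject)
  then show ?thesis using I'(6) by (auto simp: inj_on_def)
qed

text \<open>Naturality of contraction: the map on blocks is the one by which
  \<open>composite\<close> relabels its first factor.\<close>

lemma quotient_image:
  assumes \<Gamma>: "pair_graph \<Gamma>" and inj: "inj_on f (pverts \<Gamma>)" and I: "tube_partition \<Gamma> I"
  shows "image_graph (\<lambda>b. block (f ` members b)) (quotient \<Gamma> I)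
    = quotient (image_graph f \<Gamma>) ((`) f ` I)"
proof (rule image_graph_eqI)
  note I' = tube_partitionD[OF \<Gamma> I]
  show "pair_graph (quotient \<Gamma> I)" by (rule pair_graph_quotient[OF \<Gamma> I])
  show "pair_graph (quotient (image_graph f \<Gamma>) ((`) f ` I))"
    by (intro pair_graph_quotient pair_graph_image tube_partition_image assms)
  show "(\<lambda>b. block (f ` members b)) ` pverts (quotient \<Gamma> I) = pverts (quotient (image_graph f \<Gamma>) ((`) f ` I))"
    using I'(6) by (force simp: image_image)
  fix u v assume "u \<in> pverts (quotient \<Gamma> I)" "v \<in> pverts (quotient \<Gamma> I)"
  then obtain G H where uv: "u = block G" "v = block H" "G \<in> I" "H \<in> I" by auto
  have "(block (f ` G), block (f ` H)) \<in> parcs (quotient (image_graph f \<Gamma>) ((`) f ` I)) \<longleftrightarrow>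
      f ` G \<noteq> f ` H \<and> tube (image_graph f \<Gamma>) (f ` (G \<union> H))"
    unfolding image_Un
    by (rule quotient_arc_iff[OF pair_graph_image[OF \<Gamma> inj] tube_partition_image[OF assms]]) (use uv in auto)
  also have "\<dots> \<longleftrightarrow> G \<noteq> H \<and> tube \<Gamma> (G \<union> H)"
    using tube_image_iff[OF \<Gamma> inj, of "G \<union> H"] inj_on_image_eq_iff[OF inj, of G H] uv I'(7) by simp
  finally show "(block (f ` members u), block (f ` members v)) \<in> parcs (quotient (image_graph f \<Gamma>) ((`) f ` I)) \<longleftrightarrow>
      (u, v) \<in> parcs (quotient \<Gamma> I)"
    using uv I'(6) quotient_arc_iff[OF \<Gamma> I] by simp
qed

text \<open>Contracting singletons only renames vertices, and the map that undoes the renaming is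
  the one in the unit axiom.\<close>

lemma quotient_singletons:
  assumes \<Gamma>: "pair_graph \<Gamma>"
  shows "tube_partition \<Gamma> ((\<lambda>v. {v}) ` pverts \<Gamma>)"
    and "image_graph (\<lambda>b. the_elem (members b)) (quotient \<Gamma> ((\<lambda>v. {v}) ` pverts \<Gamma>)) = \<Gamma>"
proof -
  let ?I = "(\<lambda>v. {v}) ` pverts \<Gamma>"
  show I: "tube_partition \<Gamma> ?I"
    using tube_singleton[OF \<Gamma>] by (auto simp: tube_partition_def partition_on_def disjoint_def)
  show "image_graph (\<lambda>b. the_elem (members b)) (quotient \<Gamma> ?I) = \<Gamma>"
  proof (rule image_graph_eqI[OF pair_graph_quotient[OF \<Gamma> I] \<Gamma>])
    show "(\<lambda>b. the_elem (members b)) ` pverts (quotient \<Gamma> ?I) = pverts \<Gamma>"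
      by (simp add: image_image)
    fix u v assume "u \<in> pverts (quotient \<Gamma> ?I)" "v \<in> pverts (quotient \<Gamma> ?I)"
    then obtain a b where "u = block {a}" "v = block {b}" "a \<in> pverts \<Gamma>" "b \<in> pverts \<Gamma>" by auto
    moreover have "a \<noteq> b" if "(a, b) \<in> parcs \<Gamma>" for a b
      using that \<Gamma> by (auto simp: pair_graph_iff irrefl_def)
    ultimately show "(the_elem (members u), the_elem (members v)) \<in> parcs \<Gamma> \<longleftrightarrow>
        (u, v) \<in> parcs (quotient \<Gamma> ?I)"
      using quotient_arc_iff_edge[OF \<Gamma> I, of "{a}" "{b}"] by auto
  qed
qed

subsection \<open>Iterated contractions\<close>

context
  fixes \<Gamma> :: "'a vgraph" and J I
  assumes \<Gamma>: "pair_graph \<Gamma>" and J: "tube_partition \<Gamma> J" and I: "tube_partition (quotient \<Gamma> J) I"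
begin

text \<open>The vertices of \<open>quotient \<Gamma> J\<close> are blocks, so \<open>B\<close>
  amounts to a set of parts of \<open>J\<close>. As these parts are disjoint and nonempty, they can
  be read off from their union; this is why \<open>free_gamma\<close> can recover them from
  \<open>K\<close> by the test \<open>G \<subseteq> K\<close>.\<close>

lemma iterated_block:
  assumes "B \<in> I"
  shows "members ` B \<subseteq> J" "B = block ` members ` B"
    "{G \<in> J. G \<subseteq> \<Union>(members ` B)} = members ` B" "tube \<Gamma> (\<Union>(members ` B))"
proof -
  note J' = tube_partitionD[OF \<Gamma> J] and I' = tube_partitionD[OF pair_graph_quotient[OF \<Gamma> J] I]
  have B: "B \<subseteq> block ` J" using I'(7)[OF assms] by simp
  then show sub: "members ` B \<subseteq> J" and eq: "B = block ` members ` B"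
    using J'(6) by (force simp: image_image)+
  show "tube \<Gamma> (\<Union>(members ` B))"
    using I'(5)[OF assms] tube_quotient_iff[OF \<Gamma> J sub] eq by simp
  show "{G \<in> J. G \<subseteq> \<Union>(members ` B)} = members ` B"
  proof (intro set_eqI iffI)
    fix G assume G: "G \<in> {G \<in> J. G \<subseteq> \<Union>(members ` B)}"
    then obtain v where "v \<in> G" using J'(8) by blast
    then obtain H where "H \<in> members ` B" "v \<in> H" using G by blast
    then have "G = H" using J'(9)[of G H] G sub \<open>v \<in> G\<close> by blast
    then show "G \<in> members ` B" using \<open>H \<in> members ` B\<close> by simp
  qed (use sub in auto)
qed

lemma finite_flatten: "B \<in> I \<Longrightarrow> finite (\<Union>(members ` B))"
  using iterated_block(4) tubeD \<Gamma> by (metis finite_subset pair_graph_iff)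

lemma flatten_vertex_block: "B \<in> I \<Longrightarrow> flatten_vertex (block B) = block (\<Union>(members ` B))"
  using tube_partitionD(6)[OF pair_graph_quotient[OF \<Gamma> J] I] by (simp add: flatten_vertex_def)

text \<open>\<open>B\<close> is recovered from its union through the parts of \<open>J\<close> that
  the union contains.\<close>

lemma inj_on_flatten: "inj_on (\<lambda>B. \<Union>(members ` B)) I"
  by (rule inj_onI) (metis iterated_block(2,3))

lemma tube_partition_flatten: "tube_partition \<Gamma> (flatten I)"
proof -
  note J' = tube_partitionD[OF \<Gamma> J] and I' = tube_partitionD[OF pair_graph_quotient[OF \<Gamma> J] I]
  have "\<Union>(flatten I) = \<Union>(members ` \<Union>I)" by (auto simp: flatten_def)
  also have "\<dots> = pverts \<Gamma>" using I'(1) J'(1,6) by simp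
  finally have "\<Union>(flatten I) = pverts \<Gamma>" .
  moreover have "disjoint (flatten I)"
  proof (rule disjointI)
    fix K L assume "K \<in> flatten I" "L \<in> flatten I" "K \<noteq> L"
    then obtain B C where BC: "K = \<Union>(members ` B)" "L = \<Union>(members ` C)" "B \<in> I" "C \<in> I" "B \<noteq> C"
      by (auto simp: flatten_def)
    have "G \<inter> H = {}" if "G \<in> members ` B" "H \<in> members ` C" for G H
    proof -
      have "block G \<in> B" "block H \<in> C" using that iterated_block(2) BC by blast+
      then have "G \<noteq> H" using I'(9)[of B C] BC by blast
      then show ?thesis using J'(9) that iterated_block(1) BC by blast
    qed
    then show "K \<inter> L = {}" using BC by blast
  qed
  moreover have "tube \<Gamma> K" if "K \<in> flatten I" for K
    using that iterated_block(4) by (auto simp: flatten_def)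
  moreover from this have "{} \<notin> flatten I" using tubeD by blast
  ultimately show ?thesis by (auto simp: tube_partition_def partition_on_def)
qed

lemma inj_on_flatten_vertex: "inj_on flatten_vertex (pverts (quotient (quotient \<Gamma> J) I))"
proof (rule inj_onI)
  fix b c assume "b \<in> pverts (quotient (quotient \<Gamma> J) I)" "c \<in> pverts (quotient (quotient \<Gamma> J) I)"
    and *: "flatten_vertex b = flatten_vertex c"
  then obtain B C where "b = block B" "c = block C" "B \<in> I" "C \<in> I" by auto
  then show "b = c"
    using * inj_on_flatten finite_flatten block_inject by (metis (mono_tags, lifting) flatten_vertex_block inj_onD)
qed

text \<open>Adjacency says on both sides that a union of two blocks is a tube, once in
  \<open>quotient \<Gamma> J\<close> and once in \<open>\<Gamma>\<close>;
  \<open>tube_quotient_iff\<close> matches the two.\<close>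

lemma quotient_quotient:
  "image_graph flatten_vertex (quotient (quotient \<Gamma> J) I) = quotient \<Gamma> (flatten I)"
proof (rule image_graph_eqI)
  show "pair_graph (quotient (quotient \<Gamma> J) I)" by (intro pair_graph_quotient \<Gamma> J I)
  show "pair_graph (quotient \<Gamma> (flatten I))" by (intro pair_graph_quotient \<Gamma> tube_partition_flatten)
  show "flatten_vertex ` pverts (quotient (quotient \<Gamma> J) I) = pverts (quotient \<Gamma> (flatten I))"
    by (simp add: image_image flatten_vertex_block flatten_def)
  fix u v assume "u \<in> pverts (quotient (quotient \<Gamma> J) I)" "v \<in> pverts (quotient (quotient \<Gamma> J) I)"
  then obtain B C where uv: "u = block B" "v = block C" "B \<in> I" "C \<in> I" by auto
  have "(u, v) \<in> parcs (quotient (quotient \<Gamma> J) I) \<longleftrightarrow> B \<noteq> C \<and> tube (quotient \<Gamma> J) (B \<union> C)"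
    using quotient_arc_iff[OF pair_graph_quotient[OF \<Gamma> J] I] uv by simp
  also have "B \<union> C = block ` (members ` B \<union> members ` C)"
    using iterated_block(2) uv by (simp add: image_Un)
  also have "tube (quotient \<Gamma> J) \<dots> \<longleftrightarrow> tube \<Gamma> (\<Union>(members ` B \<union> members ` C))"
    using iterated_block(1) uv by (intro tube_quotient_iff[OF \<Gamma> J]) auto
  also have "\<Union>(members ` B \<union> members ` C) = \<Union>(members ` B) \<union> \<Union>(members ` C)" by simp
  also have "B \<noteq> C \<longleftrightarrow> \<Union>(members ` B) \<noteq> \<Union>(members ` C)"
    using inj_on_flatten uv by (auto dest: inj_onD)
  also have "\<Union>(members ` B) \<noteq> \<Union>(members ` C) \<and> tube \<Gamma> (\<Union>(members ` B) \<union> \<Union>(members ` C)) \<longleftrightarrow>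
      (flatten_vertex u, flatten_vertex v) \<in> parcs (quotient \<Gamma> (flatten I))"
    using quotient_arc_iff[OF \<Gamma> tube_partition_flatten] uv
    by (simp add: flatten_vertex_block flatten_def del: quotient_simps)
  finally show "(flatten_vertex u, flatten_vertex v) \<in> parcs (quotient \<Gamma> (flatten I)) \<longleftrightarrow>
      (u, v) \<in> parcs (quotient (quotient \<Gamma> J) I)" by blast
qed

text \<open>The component \<open>p B\<close> lives over a restriction of the contraction, whereas
  the composition of \<open>P\<close> expects a contraction of the restriction. These are equal and
  not merely isomorphic, because the vertex \<open>block G\<close> depends on \<open>G\<close> alone
  and a tube inside the union is the same in either graph.\<close>

lemma quotient_induced:
  assumes "B \<in> I"
  shows "tube_partition (induced \<Gamma> (\<Union>(members ` B))) (members ` B)"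
    and "quotient (induced \<Gamma> (\<Union>(members ` B))) (members ` B) = induced (quotient \<Gamma> J) B"
proof -
  let ?K = "\<Union>(members ` B)"
  note J' = tube_partitionD[OF \<Gamma> J] and B = iterated_block[OF assms]
  have K: "?K \<subseteq> pverts \<Gamma>" using B(4) tubeD by blast
  show part: "tube_partition (induced \<Gamma> ?K) (members ` B)"
    using J'(4,5,9) B(1)
    by (auto simp: tube_partition_def partition_on_def disjoint_def tube_induced[OF K] subset_eq)
  have "(block G, block H) \<in> parcs (quotient (induced \<Gamma> ?K) (members ` B)) \<longleftrightarrow>
      (block G, block H) \<in> parcs (quotient \<Gamma> J)" if "G \<in> members ` B" "H \<in> members ` B" for G H
  proof -
    have "G \<union> H \<subseteq> ?K" "G \<in> J" "H \<in> J" using that B(1) by blast+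
    then show ?thesis
      using quotient_arc_iff[OF pair_graph_induced[OF \<Gamma> K] part that] quotient_arc_iff[OF \<Gamma> J]
      by (simp add: tube_induced[OF K] del: quotient_simps)
  qed
  moreover have "parcs (quotient (induced \<Gamma> ?K) (members ` B)) \<subseteq> block ` members ` B \<times> block ` members ` B"
    using pair_graph_quotient[OF pair_graph_induced[OF \<Gamma> K] part] unfolding pair_graph_iff by simp
  ultimately have "parcs (quotient (induced \<Gamma> ?K) (members ` B)) =
      parcs (quotient \<Gamma> J) \<inter> block ` members ` B \<times> block ` members ` B"
    unfolding set_eq_iff by (auto simp del: quotient_simps)
  then show "quotient (induced \<Gamma> ?K) (members ` B) = induced (quotient \<Gamma> J) B"
    unfolding B(2)[symmetric] using B(2)
    by (intro pair_pre_digraph.equality) (simp_all del: quotient_simps(2))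
qed

end

section \<open>Leaf sequences of admissible trees\<close>

text \<open>The leaf words of trees whose leaf sets are tubes, stated without the tree. Distinctness
  and exhaustion of the vertices are left to \<open>basis_PlanEq\<close>, so the predicate applies
  to factors of an ordering; by \<open>planar_induced\<close> it can be tested in the whole
  graph.\<close>

inductive planar :: "'a vgraph \<Rightarrow> 'a vertex list \<Rightarrow> bool" for \<Gamma> where
  single: "tube \<Gamma> {v} \<Longrightarrow> planar \<Gamma> [v]"
| append: "planar \<Gamma> xs \<Longrightarrow> planar \<Gamma> ys \<Longrightarrow> tube \<Gamma> (set xs \<union> set ys) \<Longrightarrow> planar \<Gamma> (xs @ ys)"

lemma planar_iff_tree:
  "planar \<Gamma> xs \<longleftrightarrow> (\<exists>t. leaves t = xs \<and> (\<forall>s\<in>subtrees t. tube \<Gamma> (set (leaves s))))"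
proof
  assume "planar \<Gamma> xs"
  then show "\<exists>t. leaves t = xs \<and> (\<forall>s\<in>subtrees t. tube \<Gamma> (set (leaves s)))"
  proof induction
    case (single v)
    then show ?case by (intro exI[of _ "Leaf v"]) simp
  next
    case (append xs ys)
    then obtain l r where "leaves l = xs" "\<forall>s\<in>subtrees l. tube \<Gamma> (set (leaves s))"
      "leaves r = ys" "\<forall>s\<in>subtrees r. tube \<Gamma> (set (leaves s))" by auto
    with append.hyps show ?case by (intro exI[of _ "Node l r"]) auto
  qed
next
  have "planar \<Gamma> (leaves t)" if "\<forall>s\<in>subtrees t. tube \<Gamma> (set (leaves s))" for t
    using that by (induction t) (auto intro: planar.intros)
  then show "planar \<Gamma> xs" if "\<exists>t. leaves t = xs \<and> (\<forall>s\<in>subtrees t. tube \<Gamma> (set (leaves s)))"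
    using that by auto
qed

lemma basis_PlanEq: "basis PlanEq \<Gamma> = {xs \<in> permutations_of_set (pverts \<Gamma>). planar \<Gamma> xs}"
  by (auto simp: PlanEq_def admissible_def planar_iff_tree permutations_of_set_def)

lemma planar_tube: "planar \<Gamma> xs \<Longrightarrow> tube \<Gamma> (set xs)"
  by (induction rule: planar.induct) auto

lemma planar_nonempty: "planar \<Gamma> xs \<Longrightarrow> xs \<noteq> []"
  by (induction rule: planar.induct) auto

lemma planar_induced:
  assumes "S \<subseteq> pverts \<Gamma>"
  shows "planar (induced \<Gamma> S) xs \<longleftrightarrow> planar \<Gamma> xs \<and> set xs \<subseteq> S"
proof
  show "planar \<Gamma> xs \<and> set xs \<subseteq> S" if "planar (induced \<Gamma> S) xs"
    using that by induction (auto intro: planar.intros simp: tube_induced[OF assms])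
  have "planar \<Gamma> xs \<Longrightarrow> set xs \<subseteq> S \<Longrightarrow> planar (induced \<Gamma> S) xs"
    by (induction rule: planar.induct) (auto intro: planar.intros simp: tube_induced[OF assms])
  then show "planar \<Gamma> xs \<and> set xs \<subseteq> S \<Longrightarrow> planar (induced \<Gamma> S) xs" by simp
qed

lemma planar_image:
  assumes "pair_graph \<Gamma>" "inj_on f (pverts \<Gamma>)" "planar \<Gamma> xs"
  shows "planar (image_graph f \<Gamma>) (map f xs)"
  using assms(3)
proof induction
  case (single v)
  then have "tube (image_graph f \<Gamma>) (f ` {v})" using tube_image_iff[OF assms(1,2)] tubeD by blast
  then show ?case by (auto intro: planar.intros)
next
  case (append xs ys)
  then have "tube (image_graph f \<Gamma>) (f ` (set xs \<union> set ys))"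
    using tube_image_iff[OF assms(1,2)] tubeD by blast
  with append.IH show ?case by (auto simp: image_Un intro: planar.intros)
qed

text \<open>Grafting: the trees of the words \<open>w G\<close> are attached to the leaves of the
  tree of \<open>us\<close>. A node of the latter has a set of blocks as its leaf set, whose union
  is a tube by \<open>tube_quotient_iff\<close>.\<close>

lemma planar_substitute:
  assumes "pair_graph \<Gamma>" "tube_partition \<Gamma> I" "planar (quotient \<Gamma> I) us"
    and ws: "\<And>G. G \<in> I \<Longrightarrow> planar \<Gamma> (w G) \<and> set (w G) = G"
  shows "planar \<Gamma> (concat (map (\<lambda>b. w (members b)) us))"
  using assms(3)
proof induction
  case (single b)
  then have "b \<in> block ` I" using tubeD[OF single] by simp
  then show ?case using ws tube_partitionD(6)[OF assms(1,2)] by auto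
next
  case (append us vs)
  have sub: "set us \<union> set vs \<subseteq> block ` I" using tubeD[OF append.hyps(3)] by simp
  define B where "B = members ` (set us \<union> set vs)"
  have B: "B \<subseteq> I" "set us \<union> set vs = block ` B"
    using sub tube_partitionD(6)[OF assms(1,2)] by (force simp: B_def image_image)+
  have "set (concat (map (\<lambda>b. w (members b)) us)) \<union> set (concat (map (\<lambda>b. w (members b)) vs))
      = (\<Union>G\<in>B. set (w G))"
    by (auto simp: B_def)
  also have "\<dots> = \<Union>B" using ws B(1) by blast
  finally have "tube \<Gamma> (set (concat (map (\<lambda>b. w (members b)) us)) \<union> set (concat (map (\<lambda>b. w (members b)) vs)))"
    using append.hyps(3) tube_quotient_iff[OF assms(1,2) B(1)] B(2) by metis
  with append.IH show ?case by (simp only: map_append concat_append planar.append)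
qed

section \<open>Modules over PlanEq\<close>

text \<open>The membership parts of \<open>is_collection\<close> and, in
  \<open>gamma_closed\<close>, of \<open>module_axioms\<close> are separated from the equations: the
  free module must satisfy them before its equations can be transported.\<close>

definition relabel_closed :: "('a, 'b, 'z) collection_scheme \<Rightarrow> bool" where
  "relabel_closed C \<longleftrightarrow> (\<forall>\<Gamma> f x. connected_graph \<Gamma> \<longrightarrow> inj_on f (pverts \<Gamma>) \<longrightarrow> x \<in> basis C \<Gamma> \<longrightarrow>
     relabel C \<Gamma> f x \<in> basis C (image_graph f \<Gamma>))"

definition gamma_closed ::
  "('a, 'b, 'z) contractad_scheme \<Rightarrow> ('a, 'm, 'b, 'y) right_module_scheme \<Rightarrow> bool" where
  "gamma_closed P M \<longleftrightarrow> (\<forall>\<Gamma> t. connected_graph \<Gamma> \<longrightarrow> t \<in> basis (composite M P) \<Gamma> \<longrightarrow>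
     gamma M \<Gamma> t \<in> basis M \<Gamma>)"

lemma relabel_closedD:
  "relabel_closed C \<Longrightarrow> connected_graph \<Gamma> \<Longrightarrow> inj_on f (pverts \<Gamma>) \<Longrightarrow> x \<in> basis C \<Gamma> \<Longrightarrow>
     relabel C \<Gamma> f x \<in> basis C (image_graph f \<Gamma>)"
  by (simp add: relabel_closed_def)

lemma gamma_closedD:
  "gamma_closed P M \<Longrightarrow> connected_graph \<Gamma> \<Longrightarrow> t \<in> basis (composite M P) \<Gamma> \<Longrightarrow>
     gamma M \<Gamma> t \<in> basis M \<Gamma>"
  unfolding gamma_closed_def by blast

lemma mem_basis_composite:
  "(I, x, p) \<in> basis (composite V P) \<Gamma> \<longleftrightarrow>
     tube_partition \<Gamma> I \<and> x \<in> basis V (quotient \<Gamma> I) \<and> p \<in> (\<Pi>\<^sub>E G\<in>I. basis P (induced \<Gamma> G))"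
  by (simp add: composite_def)

lemma relabel_composite:
  "relabel (composite V P) \<Gamma> f (I, x, p) =
     ((`) f ` I, relabel V (quotient \<Gamma> I) (\<lambda>b. block (f ` members b)) x,
      \<lambda>H \<in> (`) f ` I. relabel P (induced \<Gamma> {v \<in> pverts \<Gamma>. f v \<in> H}) f (p {v \<in> pverts \<Gamma>. f v \<in> H}))"
  by (simp add: composite_def Let_def)

lemma preimage_image:
  "inj_on f V \<Longrightarrow> G \<subseteq> V \<Longrightarrow> {v \<in> V. f v \<in> f ` G} = G"
  by (auto dest: inj_onD)

lemma relabel_closed_composite:
  assumes V: "relabel_closed V" and P: "relabel_closed P"
  shows "relabel_closed (composite V P)"
  unfolding relabel_closed_def
proof (intro allI impI)
  fix \<Gamma> :: "'a vgraph" and f :: "'a vertex \<Rightarrow> 'a vertex" and t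
  assume \<Gamma>': "connected_graph \<Gamma>" and inj: "inj_on f (pverts \<Gamma>)" and t: "t \<in> basis (composite V P) \<Gamma>"
  obtain I x p where t_eq: "t = (I, x, p)" by (cases t)
  note \<Gamma> = connected_graphD[OF \<Gamma>']
  have I: "tube_partition \<Gamma> I" and x: "x \<in> basis V (quotient \<Gamma> I)"
    and p: "p \<in> (\<Pi>\<^sub>E G\<in>I. basis P (induced \<Gamma> G))"
    using t by (auto simp: t_eq mem_basis_composite)
  note I' = tube_partitionD[OF \<Gamma> I]
  have "relabel P (induced \<Gamma> G) f (p G) \<in> basis P (induced (image_graph f \<Gamma>) (f ` G))" if "G \<in> I" for G
    unfolding induced_image[OF \<Gamma> inj I'(7)[OF that]]
    using that I'(5,7)[OF that] inj p
    by (intro relabel_closedD[OF P] connected_graph_induced \<Gamma>) (auto intro: inj_on_subset)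
  then have "(\<lambda>H \<in> (`) f ` I. relabel P (induced \<Gamma> {v \<in> pverts \<Gamma>. f v \<in> H}) f (p {v \<in> pverts \<Gamma>. f v \<in> H}))
      \<in> (\<Pi>\<^sub>E G\<in>(`) f ` I. basis P (induced (image_graph f \<Gamma>) G))"
    using preimage_image[OF inj] I'(7) by auto
  moreover have "relabel V (quotient \<Gamma> I) (\<lambda>b. block (f ` members b)) x
      \<in> basis V (quotient (image_graph f \<Gamma>) ((`) f ` I))"
    unfolding quotient_image[OF \<Gamma> inj I, symmetric]
    using inj_on_image_block[OF \<Gamma> inj I] x
    by (intro relabel_closedD[OF V] connected_graph_quotient \<Gamma>' I) auto
  ultimately show "relabel (composite V P) \<Gamma> f t \<in> basis (composite V P) (image_graph f \<Gamma>)"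
    unfolding t_eq relabel_composite mem_basis_composite
    using tube_partition_image[OF \<Gamma> inj I] by blast
qed

text \<open>Each factor is placed in its basis by one of the two identifications:
  \<open>quotient_quotient\<close> for the element of \<open>V\<close> relabelled by
  \<open>flatten_vertex\<close>, \<open>quotient_induced\<close> for the composites in
  \<open>P\<close> over the flattened blocks.\<close>

lemma free_gamma_closed:
  assumes V: "relabel_closed V" and P: "gamma_closed P P" and \<Gamma>': "connected_graph \<Gamma>"
    and t: "t \<in> basis (composite (composite V P) P) \<Gamma>"
  shows "free_gamma V P \<Gamma> t \<in> basis (composite V P) \<Gamma>"
proof -
  obtain J I x p q where t_eq: "t = (J, (I, x, p), q)" by (metis prod_cases3)
  note \<Gamma> = connected_graphD[OF \<Gamma>']
  have J: "tube_partition \<Gamma> J" and I: "tube_partition (quotient \<Gamma> J) I"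
    and x: "x \<in> basis V (quotient (quotient \<Gamma> J) I)"
    and p: "p \<in> (\<Pi>\<^sub>E B\<in>I. basis P (induced (quotient \<Gamma> J) B))"
    and q: "q \<in> (\<Pi>\<^sub>E G\<in>J. basis P (induced \<Gamma> G))"
    using t by (auto simp: t_eq mem_basis_composite)
  note it = iterated_block[OF \<Gamma> J I]
  have x': "relabel V (quotient (quotient \<Gamma> J) I) flatten_vertex x \<in> basis V (quotient \<Gamma> (flatten I))"
    unfolding quotient_quotient[OF \<Gamma> J I, symmetric]
    by (intro relabel_closedD[OF V] inj_on_flatten_vertex[OF \<Gamma> J I] connected_graph_quotient \<Gamma>' I J x)
  have "gamma P (induced \<Gamma> K) ({G \<in> J. G \<subseteq> K}, p (block ` {G \<in> J. G \<subseteq> K}), restrict q {G \<in> J. G \<subseteq> K})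
      \<in> basis P (induced \<Gamma> K)" if "K \<in> flatten I" for K
  proof -
    obtain B where B: "B \<in> I" "K = \<Union>(members ` B)" using \<open>K \<in> flatten I\<close> by (auto simp: flatten_def)
    have ind: "induced (induced \<Gamma> K) G = induced \<Gamma> G" if "G \<in> members ` B" for G
      using that B by (intro induced_induced) auto
    have "restrict q (members ` B) \<in> (\<Pi>\<^sub>E G\<in>members ` B. basis P (induced (induced \<Gamma> K) G))"
      using q it(1)[OF B(1)] ind by (auto simp: PiE_iff subset_eq)
    moreover have "p B \<in> basis P (quotient (induced \<Gamma> K) (members ` B))"
      using p B quotient_induced(2)[OF \<Gamma> J I B(1)] by (simp add: PiE_iff)
    ultimately have "(members ` B, p B, restrict q (members ` B)) \<in> basis (composite P P) (induced \<Gamma> K)"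
      using quotient_induced(1)[OF \<Gamma> J I B(1)] B by (simp add: mem_basis_composite)
    moreover have "connected_graph (induced \<Gamma> K)"
      using connected_graph_induced[OF \<Gamma> it(4)[OF B(1)]] B by simp
    ultimately show ?thesis
      using gamma_closedD[OF P] it(2,3)[OF B(1)] B by simp
  qed
  then show ?thesis
    using x' tube_partition_flatten[OF \<Gamma> J I]
    by (auto simp: t_eq free_gamma_def mem_basis_composite Let_def)
qed

section \<open>Substitution in \<open>Perm\<close> and its restriction to
  \<open>PlanEq\<close>\<close>

lemma Perm_simps [simp]:
  "basis Perm \<Gamma> = permutations_of_set (pverts \<Gamma>)" "relabel Perm \<Gamma> f = map f"
  "gamma Perm \<Gamma> (I, us, w) = concat (map (\<lambda>b. w (members b)) us)" "unit_elt Perm v = [v]"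
  by (simp_all add: Perm_def)

lemma PlanEq_simps [simp]:
  "relabel PlanEq = relabel Perm" "gamma PlanEq = gamma Perm" "unit_elt PlanEq v = [v]"
  by (simp_all add: PlanEq_def)

lemma distinct_concat_map:
  assumes "distinct xs" "\<And>x. x \<in> set xs \<Longrightarrow> distinct (h x)"
    "\<And>x y. x \<in> set xs \<Longrightarrow> y \<in> set xs \<Longrightarrow> x \<noteq> y \<Longrightarrow> set (h x) \<inter> set (h y) = {}"
  shows "distinct (concat (map h xs))"
  using assms
proof (induction xs)
  case (Cons x xs)
  then have "set (h x) \<inter> set (h y) = {}" if "y \<in> set xs" for y using that by (metis distinct.simps(2) list.set_intros)
  then show ?case using Cons by auto
qed simp

lemma basis_PlanEq_induced:
  assumes "S \<subseteq> pverts \<Gamma>"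
  shows "basis PlanEq (induced \<Gamma> S) = {xs. distinct xs \<and> set xs = S \<and> planar \<Gamma> xs}"
  using planar_induced[OF assms] by (auto simp: basis_PlanEq permutations_of_set_def)

lemma gamma_closed_Perm: "gamma_closed PlanEq Perm"
  unfolding gamma_closed_def
proof (intro allI impI)
  fix \<Gamma> :: "'a vgraph" and t
  assume \<Gamma>': "connected_graph \<Gamma>" and t: "t \<in> basis (composite Perm PlanEq) \<Gamma>"
  obtain I us w where t_eq: "t = (I, us, w)" by (metis prod_cases3)
  note \<Gamma> = connected_graphD[OF \<Gamma>']
  have I: "tube_partition \<Gamma> I" and us: "set us = block ` I" "distinct us"
    and w: "\<And>G. G \<in> I \<Longrightarrow> w G \<in> basis PlanEq (induced \<Gamma> G)"
    using t by (auto simp: t_eq mem_basis_composite permutations_of_set_def)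
  note I' = tube_partitionD[OF \<Gamma> I]
  have w': "distinct (w G)" "set (w G) = G" if "G \<in> I" for G
    using w[OF that] I'(7)[OF that] by (simp_all add: basis_PlanEq_induced)
  have "distinct (concat (map (\<lambda>b. w (members b)) us))"
  proof (rule distinct_concat_map[OF us(2)])
    fix b c assume "b \<in> set us" "c \<in> set us" "b \<noteq> c"
    then obtain G H where "b = block G" "c = block H" "G \<in> I" "H \<in> I" "G \<noteq> H" using us by auto
    then show "set (w (members b)) \<inter> set (w (members c)) = {}" using w'(2) I'(6,9) by simp
  qed (use us(1) w'(1) I'(6) in auto)
  moreover have "set (concat (map (\<lambda>b. w (members b)) us)) = pverts \<Gamma>"
    using us(1) w'(2) I'(1,6) by auto
  ultimately show "gamma Perm \<Gamma> t \<in> basis Perm \<Gamma>"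
    by (simp add: t_eq permutations_of_set_def)
qed

lemma basis_composite_mono:
  assumes "basis V (quotient \<Gamma> (fst t)) \<subseteq> basis V' (quotient \<Gamma> (fst t))" "t \<in> basis (composite V P) \<Gamma>"
  shows "t \<in> basis (composite V' P) \<Gamma>"
  using assms by (cases t) (auto simp: mem_basis_composite)

text \<open>Makes \<open>PlanEq\<close> a subcontractad of \<open>Perm\<close>: grafting of trees
  gives planarity, and closure of \<open>Perm\<close> gives an ordering of all vertices.\<close>

lemma gamma_closed_PlanEq: "gamma_closed PlanEq PlanEq"
  unfolding gamma_closed_def
proof (intro allI impI)
  fix \<Gamma> :: "'a vgraph" and t
  assume \<Gamma>': "connected_graph \<Gamma>" and t: "t \<in> basis (composite PlanEq PlanEq) \<Gamma>"
  obtain I us w where t_eq: "t = (I, us, w)" by (metis prod_cases3)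
  note \<Gamma> = connected_graphD[OF \<Gamma>']
  have I: "tube_partition \<Gamma> I" and us: "planar (quotient \<Gamma> I) us"
    and w: "\<And>G. G \<in> I \<Longrightarrow> w G \<in> basis PlanEq (induced \<Gamma> G)"
    using t by (auto simp: t_eq mem_basis_composite basis_PlanEq[of "quotient \<Gamma> I"])
  have "planar \<Gamma> (w G) \<and> set (w G) = G" if "G \<in> I" for G
    using w[OF that] tube_partitionD(7)[OF \<Gamma> I that] by (simp add: basis_PlanEq_induced)
  then have "planar \<Gamma> (gamma Perm \<Gamma> t)" using planar_substitute[OF \<Gamma> I us] by (simp add: t_eq)
  moreover have "t \<in> basis (composite Perm PlanEq) \<Gamma>"
    using t by (rule basis_composite_mono[rotated]) (auto simp: basis_PlanEq)
  then have "gamma Perm \<Gamma> t \<in> basis Perm \<Gamma>" by (rule gamma_closedD[OF gamma_closed_Perm \<Gamma>'])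
  ultimately show "gamma PlanEq \<Gamma> t \<in> basis PlanEq \<Gamma>" by (simp add: basis_PlanEq)
qed

lemma map_mem_permutations_of_set:
  "inj_on f V \<Longrightarrow> xs \<in> permutations_of_set V \<Longrightarrow> map f xs \<in> permutations_of_set (f ` V)"
  by (auto simp: permutations_of_set_def distinct_map)

lemma relabel_closed_PlanEq: "relabel_closed PlanEq"
  by (simp add: relabel_closed_def basis_PlanEq map_mem_permutations_of_set planar_image connected_graphD)

lemma unit_mem_PlanEq: "unit_elt PlanEq v \<in> basis PlanEq \<lparr>pverts = {v}, parcs = {}\<rparr>"
proof -
  have "tube \<lparr>pverts = {v}, parcs = {}\<rparr> {v}"
    by (rule tube_singleton) (simp_all add: pair_graph_iff sym_def irrefl_def)
  then show ?thesis by (auto simp: basis_PlanEq permutations_of_set_def intro: planar.intros)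
qed

lemma is_collection_Perm: "is_collection Perm"
  unfolding is_collection_def
proof (intro allI impI conjI ballI)
  fix \<Gamma> :: "'a vgraph" and f :: "'a vertex \<Rightarrow> 'a vertex" and x
  assume "inj_on f (pverts \<Gamma>)" "x \<in> basis Perm \<Gamma>"
  then show "relabel Perm \<Gamma> f x \<in> basis Perm (image_graph f \<Gamma>)"
    by (simp add: map_mem_permutations_of_set)
next
  fix \<Gamma> :: "'a vgraph" and f g :: "'a vertex \<Rightarrow> 'a vertex" and x
  assume "x \<in> basis Perm \<Gamma>" "\<forall>v\<in>pverts \<Gamma>. f v = g v"
  then show "relabel Perm \<Gamma> f x = relabel Perm \<Gamma> g x"
    by (simp add: permutations_of_set_def)
qed simp_all

lemma concat_map_concat: "concat (map h (concat xss)) = concat (map (\<lambda>xs. concat (map h xs)) xss)"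
  by (induction xss) simp_all

text \<open>The one place where module equations are computed. Both sides are concatenations along
  \<open>us\<close>, and associativity amounts to flattening a nested concatenation in two
  ways.\<close>

lemma module_axioms_Perm: "module_axioms PlanEq Perm"
  unfolding module_axioms_def Let_def
proof (intro conjI allI impI ballI is_collection_Perm)
  fix \<Gamma> :: "'a vgraph" and t
  assume "connected_graph \<Gamma>" "t \<in> basis (composite Perm PlanEq) \<Gamma>"
  then show "gamma Perm \<Gamma> t \<in> basis Perm \<Gamma>" by (rule gamma_closedD[OF gamma_closed_Perm])
next
  fix \<Gamma> :: "'a vgraph" and t and f :: "'a vertex \<Rightarrow> 'a vertex"
  assume \<Gamma>: "connected_graph \<Gamma>" and t: "t \<in> basis (composite Perm PlanEq) \<Gamma>" and inj: "inj_on f (pverts \<Gamma>)"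
  obtain I us w where t_eq: "t = (I, us, w)" by (metis prod_cases3)
  have I: "tube_partition \<Gamma> I" and us: "set us = block ` I"
    using t by (auto simp: t_eq mem_basis_composite permutations_of_set_def)
  note I' = tube_partitionD[OF connected_graphD[OF \<Gamma>] I]
  show "relabel Perm \<Gamma> f (gamma Perm \<Gamma> t) = gamma Perm (image_graph f \<Gamma>) (relabel (composite Perm PlanEq) \<Gamma> f t)"
    using us I'(6,7) preimage_image[OF inj]
    by (auto simp: t_eq relabel_composite map_concat intro!: arg_cong[of _ _ concat])
next
  fix \<Gamma> :: "'a vgraph" and J s q
  assume \<Gamma>': "connected_graph \<Gamma>" and t: "(J, s, q) \<in> basis (composite (composite Perm PlanEq) PlanEq) \<Gamma>"
  obtain I us p where s: "s = (I, us, p)" by (metis prod_cases3)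
  note \<Gamma> = connected_graphD[OF \<Gamma>']
  have J: "tube_partition \<Gamma> J" and I: "tube_partition (quotient \<Gamma> J) I" and us: "set us = block ` I"
    and p: "\<And>B. B \<in> I \<Longrightarrow> p B \<in> basis PlanEq (induced (quotient \<Gamma> J) B)"
    using t by (auto simp: s mem_basis_composite permutations_of_set_def)
  note it = iterated_block[OF \<Gamma> J I] and finI = tube_partitionD(6)[OF pair_graph_quotient[OF \<Gamma> J] I]
  \<comment> \<open>One vertex \<open>b\<close> of the outer word at a time: substituting
    \<open>q\<close> into the word \<open>p B\<close> gives what \<open>free_gamma\<close> assigns
    to the union of the parts in \<open>B\<close>. The letters of \<open>p B\<close> are exactly
    \<open>B\<close>, so restricting \<open>q\<close> to these parts changes nothing.\<close>
  have "concat (map (\<lambda>b. q (members b)) (p (members b))) =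
      snd (snd (free_gamma Perm PlanEq \<Gamma> (J, s, q))) (members (flatten_vertex b))" if b: "b \<in> set us" for b
  proof -
    obtain B where B: "b = block B" "B \<in> I" using b us by auto
    have "set (p B) = B" using p[OF B(2)] by (simp add: basis_PlanEq permutations_of_set_def)
    have "\<Union>(members ` B) \<in> flatten I" using B(2) by (auto simp: flatten_def)
    then have "snd (snd (free_gamma Perm PlanEq \<Gamma> (J, s, q))) (\<Union>(members ` B))
        = gamma PlanEq (induced \<Gamma> (\<Union>(members ` B))) (members ` B, p B, restrict q (members ` B))"
      unfolding free_gamma_def s prod.case snd_conv Let_def restrict_apply
      by (simp only: if_True it(3)[OF B(2)] it(2)[OF B(2), symmetric])
    also have "\<dots> = concat (map (\<lambda>b. q (members b)) (p B))"
      using \<open>set (p B) = B\<close> by (auto intro!: arg_cong[of _ _ concat])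
    finally show ?thesis
      using B finI[OF B(2)] finite_flatten[OF \<Gamma> J I B(2)] flatten_vertex_block[OF \<Gamma> J I B(2)] by simp
  qed
  then show "gamma Perm \<Gamma> (J, gamma Perm (quotient \<Gamma> J) s, q) = gamma Perm \<Gamma> (free_gamma Perm PlanEq \<Gamma> (J, s, q))"
    by (simp add: s free_gamma_def concat_map_concat comp_def cong: map_cong)
next
  fix \<Gamma> :: "'a vgraph" and x
  assume "connected_graph \<Gamma>" "x \<in> basis Perm (quotient \<Gamma> ((\<lambda>v. {v}) ` pverts \<Gamma>))"
  then have "set x = block ` (\<lambda>v. {v}) ` pverts \<Gamma>" by (simp add: permutations_of_set_def)
  then have "map (\<lambda>b. (\<lambda>S\<in>(\<lambda>v. {v}) ` pverts \<Gamma>. unit_elt PlanEq (the_elem S)) (members b)) x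
      = map (\<lambda>b. [the_elem (members b)]) x" by auto
  then show "gamma Perm \<Gamma> ((\<lambda>v. {v}) ` pverts \<Gamma>, x, \<lambda>S\<in>(\<lambda>v. {v}) ` pverts \<Gamma>. unit_elt PlanEq (the_elem S))
      = relabel Perm (quotient \<Gamma> ((\<lambda>v. {v}) ` pverts \<Gamma>)) (\<lambda>b. the_elem (members b)) x"
    by (simp only: Perm_simps concat_map_singleton)
qed

section \<open>Transport of module axioms along an injection\<close>

lemma module_axiomsD:
  assumes "module_axioms P M" "connected_graph \<Gamma>"
  shows "is_collection M"
    and "t \<in> basis (composite M P) \<Gamma> \<Longrightarrow> gamma M \<Gamma> t \<in> basis M \<Gamma>"
    and "t \<in> basis (composite M P) \<Gamma> \<Longrightarrow> inj_on f (pverts \<Gamma>) \<Longrightarrow>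
      relabel M \<Gamma> f (gamma M \<Gamma> t) = gamma M (image_graph f \<Gamma>) (relabel (composite M P) \<Gamma> f t)"
    and "(J, s, q) \<in> basis (composite (composite M P) P) \<Gamma> \<Longrightarrow>
      gamma M \<Gamma> (J, gamma M (quotient \<Gamma> J) s, q) = gamma M \<Gamma> (free_gamma M P \<Gamma> (J, s, q))"
    and "I = (\<lambda>v. {v}) ` pverts \<Gamma> \<Longrightarrow> x \<in> basis M (quotient \<Gamma> I) \<Longrightarrow>
      gamma M \<Gamma> (I, x, \<lambda>S\<in>I. unit_elt P (the_elem S))
        = relabel M (quotient \<Gamma> I) (\<lambda>b. the_elem (members b)) x"
proof -
  show "is_collection M" using assms(1) by (simp add: module_axioms_def)
  note ax = assms(1)[unfolded module_axioms_def Let_def, THEN conjunct2, THEN spec, THEN mp, OF assms(2)]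
  show "t \<in> basis (composite M P) \<Gamma> \<Longrightarrow> gamma M \<Gamma> t \<in> basis M \<Gamma>"
    using ax[THEN conjunct1] by (rule bspec)
  show "t \<in> basis (composite M P) \<Gamma> \<Longrightarrow> inj_on f (pverts \<Gamma>) \<Longrightarrow>
      relabel M \<Gamma> f (gamma M \<Gamma> t) = gamma M (image_graph f \<Gamma>) (relabel (composite M P) \<Gamma> f t)"
    by (rule ax[THEN conjunct2, THEN conjunct1, THEN bspec, THEN spec, THEN mp])
  show "(J, s, q) \<in> basis (composite (composite M P) P) \<Gamma> \<Longrightarrow>
      gamma M \<Gamma> (J, gamma M (quotient \<Gamma> J) s, q) = gamma M \<Gamma> (free_gamma M P \<Gamma> (J, s, q))"
    by (rule ax[THEN conjunct2, THEN conjunct2, THEN conjunct1, THEN spec, THEN spec, THEN spec, THEN mp])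
  show "I = (\<lambda>v. {v}) ` pverts \<Gamma> \<Longrightarrow> x \<in> basis M (quotient \<Gamma> I) \<Longrightarrow>
      gamma M \<Gamma> (I, x, \<lambda>S\<in>I. unit_elt P (the_elem S))
        = relabel M (quotient \<Gamma> I) (\<lambda>b. the_elem (members b)) x"
    by (simp only:) (rule ax[THEN conjunct2, THEN conjunct2, THEN conjunct2, THEN bspec])
qed

lemma is_collectionD:
  assumes "is_collection C" "connected_graph \<Gamma>" "x \<in> basis C \<Gamma>"
  shows "relabel C \<Gamma> id x = x"
    and "inj_on f (pverts \<Gamma>) \<Longrightarrow> \<forall>v\<in>pverts \<Gamma>. f v = g v \<Longrightarrow> relabel C \<Gamma> f x = relabel C \<Gamma> g x"
    and "inj_on f (pverts \<Gamma>) \<Longrightarrow> inj_on g (f ` pverts \<Gamma>) \<Longrightarrow>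
           relabel C (image_graph f \<Gamma>) g (relabel C \<Gamma> f x) = relabel C \<Gamma> (g \<circ> f) x"
  using assms unfolding is_collection_def by blast+

lemma image_graph_id: "image_graph id \<Gamma> = \<Gamma>"
  by (intro pair_pre_digraph.equality) (simp_all add: prod.map_id0)

lemma image_graph_comp: "image_graph g (image_graph f \<Gamma>) = image_graph (g \<circ> f) \<Gamma>"
  by (simp add: image_graph_def image_comp prod.map_comp)

lemma image_graph_cong:
  assumes "pair_graph \<Gamma>" "\<forall>v\<in>pverts \<Gamma>. f v = g v"
  shows "image_graph f \<Gamma> = image_graph g \<Gamma>"
proof -
  have "map_prod f f e = map_prod g g e" if "e \<in> parcs \<Gamma>" for e
    using that assms by (cases e) (auto simp: pair_graph_iff)
  then show ?thesis using assms(2) by (simp add: image_graph_def cong: image_cong)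
qed

text \<open>Each axiom for \<open>N\<close> is checked after applying the injection \<open>\<psi>\<close>, where it is an axiom for \<open>M\<close>.\<close>

lemma module_axioms_transport:
  fixes P :: "('a, 'b, 'z) contractad_scheme"
    and M :: "('a, 'm, 'b, 'x) right_module_scheme" and N :: "('a, 'n, 'b, 'y) right_module_scheme"
    and \<psi> :: "'a vgraph \<Rightarrow> 'n \<Rightarrow> 'm"
  assumes M: "module_axioms P M"
    and P: "relabel_closed P" "gamma_closed P P"
      "\<And>v. unit_elt P v \<in> basis P \<lparr>pverts = {v}, parcs = {}\<rparr>"
    and N: "relabel_closed N" "gamma_closed P N"
    and inj: "\<And>\<Gamma>. connected_graph \<Gamma> \<Longrightarrow> inj_on (\<psi> \<Gamma>) (basis N \<Gamma>)"
    and in_M: "\<And>\<Gamma> x. connected_graph \<Gamma> \<Longrightarrow> x \<in> basis N \<Gamma> \<Longrightarrow> \<psi> \<Gamma> x \<in> basis M \<Gamma>"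
    and rel: "\<And>\<Gamma> f x. connected_graph \<Gamma> \<Longrightarrow> inj_on f (pverts \<Gamma>) \<Longrightarrow> x \<in> basis N \<Gamma> \<Longrightarrow>
      \<psi> (image_graph f \<Gamma>) (relabel N \<Gamma> f x) = relabel M \<Gamma> f (\<psi> \<Gamma> x)"
    and gam: "\<And>\<Gamma> I x p. connected_graph \<Gamma> \<Longrightarrow> (I, x, p) \<in> basis (composite N P) \<Gamma> \<Longrightarrow>
      \<psi> \<Gamma> (gamma N \<Gamma> (I, x, p)) = gamma M \<Gamma> (I, \<psi> (quotient \<Gamma> I) x, p)"
  shows "module_axioms P N"
proof -
  note rel_N = relabel_closedD[OF N(1)] and gam_N = gamma_closedD[OF N(2)]
  have eqI: "x = y" if "connected_graph \<Gamma>" "x \<in> basis N \<Gamma>" "y \<in> basis N \<Gamma>" "\<psi> \<Gamma> x = \<psi> \<Gamma> y" for \<Gamma> x y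
    using inj[OF that(1)] that(2-4) by (rule_tac inj_onD)
  have comp_M: "(I, \<psi> (quotient \<Gamma> I) x, p) \<in> basis (composite M P) \<Gamma>"
    if "connected_graph \<Gamma>" "(I, x, p) \<in> basis (composite N P) \<Gamma>" for \<Gamma> I x p
    using that in_M connected_graph_quotient by (auto simp: mem_basis_composite)
  have M_coll: "is_collection M" using M by (simp add: module_axioms_def)
  have "is_collection N"
    unfolding is_collection_def
  proof (intro allI impI conjI ballI)
    fix \<Gamma> x assume \<Gamma>: "connected_graph \<Gamma>" and x: "x \<in> basis N \<Gamma>"
    show "relabel N \<Gamma> id x = x"
    proof (rule eqI[OF \<Gamma> _ x])
      show "relabel N \<Gamma> id x \<in> basis N \<Gamma>" using rel_N[OF \<Gamma> _ x, of id] by (simp add: image_graph_id)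
      show "\<psi> \<Gamma> (relabel N \<Gamma> id x) = \<psi> \<Gamma> x"
        using rel[OF \<Gamma> _ x, of id] is_collectionD(1)[OF M_coll \<Gamma> in_M[OF \<Gamma> x]] by (simp add: image_graph_id)
    qed
    fix f :: "'a vertex \<Rightarrow> 'a vertex" assume f: "inj_on f (pverts \<Gamma>)"
    show fx: "relabel N \<Gamma> f x \<in> basis N (image_graph f \<Gamma>)" by (rule rel_N[OF \<Gamma> f x])
    have f\<Gamma>: "connected_graph (image_graph f \<Gamma>)" by (rule connected_graph_image[OF \<Gamma> f])
    {
      fix g :: "'a vertex \<Rightarrow> 'a vertex" assume fg: "\<forall>v\<in>pverts \<Gamma>. f v = g v"
      then have g: "inj_on g (pverts \<Gamma>)" using f by (simp add: inj_on_def)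
      have im: "image_graph f \<Gamma> = image_graph g \<Gamma>"
        by (rule image_graph_cong[OF connected_graphD[OF \<Gamma>] fg])
      show "relabel N \<Gamma> f x = relabel N \<Gamma> g x"
      proof (rule eqI[OF f\<Gamma> fx])
        show "relabel N \<Gamma> g x \<in> basis N (image_graph f \<Gamma>)" unfolding im by (rule rel_N[OF \<Gamma> g x])
        show "\<psi> (image_graph f \<Gamma>) (relabel N \<Gamma> f x) = \<psi> (image_graph f \<Gamma>) (relabel N \<Gamma> g x)"
          using rel[OF \<Gamma> f x] rel[OF \<Gamma> g x] is_collectionD(2)[OF M_coll \<Gamma> in_M[OF \<Gamma> x] f fg] im by simp
      qed
    next
      fix g :: "'a vertex \<Rightarrow> 'a vertex" assume g: "inj_on g (f ` pverts \<Gamma>)"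
      then have gf: "inj_on (g \<circ> f) (pverts \<Gamma>)" using f by (rule_tac comp_inj_on)
      have g': "inj_on g (pverts (image_graph f \<Gamma>))" using g by simp
      note im = image_graph_comp[of g f \<Gamma>]
      show "relabel N (image_graph f \<Gamma>) g (relabel N \<Gamma> f x) = relabel N \<Gamma> (g \<circ> f) x"
      proof (rule eqI[OF connected_graph_image[OF \<Gamma> gf]])
        show "relabel N (image_graph f \<Gamma>) g (relabel N \<Gamma> f x) \<in> basis N (image_graph (g \<circ> f) \<Gamma>)"
          unfolding im[symmetric] by (rule rel_N[OF f\<Gamma> g' fx])
        show "relabel N \<Gamma> (g \<circ> f) x \<in> basis N (image_graph (g \<circ> f) \<Gamma>)" by (rule rel_N[OF \<Gamma> gf x])
        show "\<psi> (image_graph (g \<circ> f) \<Gamma>) (relabel N (image_graph f \<Gamma>) g (relabel N \<Gamma> f x))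
            = \<psi> (image_graph (g \<circ> f) \<Gamma>) (relabel N \<Gamma> (g \<circ> f) x)"
          using rel[OF \<Gamma> f x] rel[OF \<Gamma> gf x] rel[OF f\<Gamma> g' fx]
            is_collectionD(3)[OF M_coll \<Gamma> in_M[OF \<Gamma> x] f g] im by simp
      qed
    }
  qed
  then show ?thesis
    unfolding module_axioms_def Let_def
  proof (intro conjI allI impI ballI)
    fix \<Gamma> t assume \<Gamma>: "connected_graph \<Gamma>" and t: "t \<in> basis (composite N P) \<Gamma>"
    show \<gamma>t: "gamma N \<Gamma> t \<in> basis N \<Gamma>" by (rule gam_N[OF \<Gamma> t])
    fix f :: "'a vertex \<Rightarrow> 'a vertex" assume f: "inj_on f (pverts \<Gamma>)"
    obtain I x p where t_eq: "t = (I, x, p)" by (metis prod_cases3)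
    have f\<Gamma>: "connected_graph (image_graph f \<Gamma>)" by (rule connected_graph_image[OF \<Gamma> f])
    have ft: "relabel (composite N P) \<Gamma> f t \<in> basis (composite N P) (image_graph f \<Gamma>)"
      by (rule relabel_closedD[OF relabel_closed_composite[OF N(1) P(1)] \<Gamma> f t])
    have I: "tube_partition \<Gamma> I" and x: "x \<in> basis N (quotient \<Gamma> I)"
      using t by (simp_all add: t_eq mem_basis_composite)
    note \<Gamma>' = connected_graphD[OF \<Gamma>]
    show "relabel N \<Gamma> f (gamma N \<Gamma> t) = gamma N (image_graph f \<Gamma>) (relabel (composite N P) \<Gamma> f t)"
    proof (rule eqI[OF f\<Gamma> rel_N[OF \<Gamma> f \<gamma>t] gam_N[OF f\<Gamma> ft]])
      have "\<psi> (image_graph f \<Gamma>) (relabel N \<Gamma> f (gamma N \<Gamma> t)) = relabel M \<Gamma> f (\<psi> \<Gamma> (gamma N \<Gamma> t))"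
        by (rule rel[OF \<Gamma> f \<gamma>t])
      also have "\<dots> = relabel M \<Gamma> f (gamma M \<Gamma> (I, \<psi> (quotient \<Gamma> I) x, p))"
        using gam[OF \<Gamma>] t by (simp add: t_eq)
      also have "\<dots> = gamma M (image_graph f \<Gamma>) (relabel (composite M P) \<Gamma> f (I, \<psi> (quotient \<Gamma> I) x, p))"
        using module_axiomsD(3)[OF M \<Gamma> comp_M[OF \<Gamma>] f] t t_eq by blast
      also have "\<dots> = \<psi> (image_graph f \<Gamma>) (gamma N (image_graph f \<Gamma>) (relabel (composite N P) \<Gamma> f t))"
      proof -
        \<comment> \<open>The first factor of a composite is relabelled by the induced map of
          contractions, so compatibility of \<open>\<psi>\<close> with relabelling is used at the
          contracted graph.\<close>
        have g: "inj_on (\<lambda>b. block (f ` members b)) (pverts (quotient \<Gamma> I))"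
          using inj_on_image_block[OF \<Gamma>' f I] by simp
        show ?thesis
          using ft rel[OF connected_graph_quotient[OF \<Gamma> I] g x]
          unfolding t_eq relabel_composite quotient_image[OF \<Gamma>' f I]
          by (simp only: gam[OF f\<Gamma>])
      qed
      finally show "\<psi> (image_graph f \<Gamma>) (relabel N \<Gamma> f (gamma N \<Gamma> t)) =
          \<psi> (image_graph f \<Gamma>) (gamma N (image_graph f \<Gamma>) (relabel (composite N P) \<Gamma> f t))" .
    qed
  next
    fix \<Gamma> J s q assume \<Gamma>: "connected_graph \<Gamma>" and t: "(J, s, q) \<in> basis (composite (composite N P) P) \<Gamma>"
    obtain I x p where s: "s = (I, x, p)" by (metis prod_cases3)
    note \<Gamma>' = connected_graphD[OF \<Gamma>]
    have J: "tube_partition \<Gamma> J" and q: "q \<in> (\<Pi>\<^sub>E G\<in>J. basis P (induced \<Gamma> G))"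
      and sN: "s \<in> basis (composite N P) (quotient \<Gamma> J)"
      using t by (simp_all add: mem_basis_composite)
    have \<Gamma>J: "connected_graph (quotient \<Gamma> J)" by (rule connected_graph_quotient[OF \<Gamma> J])
    have I: "tube_partition (quotient \<Gamma> J) I" and x: "x \<in> basis N (quotient (quotient \<Gamma> J) I)"
      using sN by (simp_all add: s mem_basis_composite)
    have Jsq: "(J, gamma N (quotient \<Gamma> J) s, q) \<in> basis (composite N P) \<Gamma>"
      using J q gam_N[OF \<Gamma>J sN] by (simp add: mem_basis_composite)
    have fr: "free_gamma N P \<Gamma> (J, s, q) \<in> basis (composite N P) \<Gamma>"
      by (rule free_gamma_closed[OF N(1) P(2) \<Gamma> t])
    \<comment> \<open>The family \<open>r\<close> of composites in \<open>P\<close> is built from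
      \<open>p\<close> and \<open>q\<close> alone, so the same \<open>r\<close> serves for
      \<open>N\<close> and for \<open>M\<close>.\<close>
    obtain r where r: "free_gamma N P \<Gamma> (J, s, q)
        = (flatten I, relabel N (quotient (quotient \<Gamma> J) I) flatten_vertex x, r)"
      and r': "free_gamma M P \<Gamma> (J, (I, \<psi> (quotient (quotient \<Gamma> J) I) x, p), q)
        = (flatten I, relabel M (quotient (quotient \<Gamma> J) I) flatten_vertex (\<psi> (quotient (quotient \<Gamma> J) I) x), r)"
      by (simp add: s free_gamma_def)
    show "gamma N \<Gamma> (J, gamma N (quotient \<Gamma> J) s, q) = gamma N \<Gamma> (free_gamma N P \<Gamma> (J, s, q))"
    proof (rule eqI[OF \<Gamma> gam_N[OF \<Gamma> Jsq] gam_N[OF \<Gamma> fr]])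
      have "\<psi> \<Gamma> (gamma N \<Gamma> (J, gamma N (quotient \<Gamma> J) s, q))
          = gamma M \<Gamma> (J, \<psi> (quotient \<Gamma> J) (gamma N (quotient \<Gamma> J) s), q)"
        by (rule gam[OF \<Gamma> Jsq])
      also have "\<psi> (quotient \<Gamma> J) (gamma N (quotient \<Gamma> J) s)
          = gamma M (quotient \<Gamma> J) (I, \<psi> (quotient (quotient \<Gamma> J) I) x, p)"
        using gam[OF \<Gamma>J] sN by (simp add: s)
      also have "gamma M \<Gamma> (J, gamma M (quotient \<Gamma> J) (I, \<psi> (quotient (quotient \<Gamma> J) I) x, p), q)
          = gamma M \<Gamma> (free_gamma M P \<Gamma> (J, (I, \<psi> (quotient (quotient \<Gamma> J) I) x, p), q))"
        using comp_M[OF \<Gamma>J, of I x p] sN J q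
        by (intro module_axiomsD(4)[OF M \<Gamma>]) (simp add: s mem_basis_composite[of J])
      also have "\<dots> = gamma M \<Gamma> (flatten I, \<psi> (quotient \<Gamma> (flatten I))
          (relabel N (quotient (quotient \<Gamma> J) I) flatten_vertex x), r)"
        using rel[OF connected_graph_quotient[OF \<Gamma>J I] inj_on_flatten_vertex[OF \<Gamma>' J I] x]
          quotient_quotient[OF \<Gamma>' J I] r' by simp
      also have "\<dots> = \<psi> \<Gamma> (gamma N \<Gamma> (free_gamma N P \<Gamma> (J, s, q)))"
        using gam[OF \<Gamma>] fr r by simp
      finally show "\<psi> \<Gamma> (gamma N \<Gamma> (J, gamma N (quotient \<Gamma> J) s, q))
          = \<psi> \<Gamma> (gamma N \<Gamma> (free_gamma N P \<Gamma> (J, s, q)))" .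
    qed
  next
    fix \<Gamma> :: "'a vgraph" and x assume \<Gamma>: "connected_graph \<Gamma>"
    define I where "I = (\<lambda>v. {v}) ` pverts \<Gamma>"
    assume "x \<in> basis N (quotient \<Gamma> ((\<lambda>v. {v}) ` pverts \<Gamma>))"
    then have x: "x \<in> basis N (quotient \<Gamma> I)" by (simp add: I_def)
    note \<Gamma>' = connected_graphD[OF \<Gamma>]
    let ?u = "\<lambda>S\<in>I. unit_elt P (the_elem S)" and ?h = "\<lambda>b. the_elem (members b)"
    have I: "tube_partition \<Gamma> I" and im: "image_graph ?h (quotient \<Gamma> I) = \<Gamma>"
      using quotient_singletons[OF \<Gamma>'] by (simp_all add: I_def)
    note \<Gamma>I = connected_graph_quotient[OF \<Gamma> I]
    have h: "inj_on ?h (pverts (quotient \<Gamma> I))" by (auto simp: I_def inj_on_def)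
    \<comment> \<open>There are no loops, so restricting to one vertex gives exactly the arcless
      graph over which the unit lives.\<close>
    have "induced \<Gamma> {v} = \<lparr>pverts = {v}, parcs = {}\<rparr>" for v
      using \<Gamma>' by (auto simp: induced_def pair_graph_iff irrefl_def)
    then have t: "(I, x, ?u) \<in> basis (composite N P) \<Gamma>"
      using I x P(3) by (auto simp: mem_basis_composite I_def)
    have "gamma N \<Gamma> (I, x, ?u) = relabel N (quotient \<Gamma> I) ?h x"
    proof (rule eqI[OF \<Gamma> gam_N[OF \<Gamma> t]])
      show "relabel N (quotient \<Gamma> I) ?h x \<in> basis N \<Gamma>" using rel_N[OF \<Gamma>I h x] im by simp
      show "\<psi> \<Gamma> (gamma N \<Gamma> (I, x, ?u)) = \<psi> \<Gamma> (relabel N (quotient \<Gamma> I) ?h x)"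
        using gam[OF \<Gamma> t] module_axiomsD(5)[OF M \<Gamma> I_def in_M[OF \<Gamma>I x]] rel[OF \<Gamma>I h x] im by simp
    qed
    then show "gamma N \<Gamma> ((\<lambda>v. {v}) ` pverts \<Gamma>, x, \<lambda>S\<in>(\<lambda>v. {v}) ` pverts \<Gamma>. unit_elt P (the_elem S))
        = relabel N (quotient \<Gamma> ((\<lambda>v. {v}) ` pverts \<Gamma>)) ?h x"
      by (simp add: I_def)
  qed
qed

text \<open>Over itself, \<open>PlanEq\<close> is a submodule of \<open>Perm\<close>, so the axioms
  are transported along the inclusion. The left unit law holds because a word substituted for the
  only letter of a word is itself the result.\<close>

lemma is_contractad_PlanEq: "is_contractad PlanEq"
proof -
  have "module_axioms PlanEq PlanEq"
  proof (rule module_axioms_transport[where \<psi> = "\<lambda>\<Gamma> x. x", OF module_axioms_Perm relabel_closed_PlanEq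
        gamma_closed_PlanEq unit_mem_PlanEq relabel_closed_PlanEq gamma_closed_PlanEq])
  qed (auto simp: basis_PlanEq)
  moreover have "gamma PlanEq \<Gamma> ({pverts \<Gamma>}, unit_elt PlanEq (block (pverts \<Gamma>)), \<lambda>G\<in>{pverts \<Gamma>}. y) = y"
    if "connected_graph \<Gamma>" for \<Gamma> :: "'a vgraph" and y
    using that by (auto dest!: connected_graphD simp: pair_graph_iff)
  ultimately show ?thesis
    using unit_mem_PlanEq by (auto simp: is_contractad_def)
qed

section \<open>Decomposing an ordering into planar blocks\<close>

text \<open>If a word ends with \<open>x\<close>, the next one must begin with \<open>y\<close>,
  since it is not empty; so no further word can lie between the two letters.\<close>

lemma adjacent_in_concat:
  assumes "concat wss = c @ x # y # d" "[] \<notin> set wss"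
  shows "(\<exists>w\<in>set wss. x \<in> set w \<and> y \<in> set w) \<or>
    (\<exists>vss v w uss. wss = vss @ v # w # uss \<and> x \<in> set v \<and> y \<in> set w)"
  using assms
proof (induction wss arbitrary: c)
  case (Cons w wss)
  have IH: ?case if "concat wss = c' @ x # y # d" for c'
    using Cons.IH[OF that] Cons.prems(2) by (metis append_Cons list.set_intros(2) set_ConsD list.set_intros(1))
  from Cons.prems(1) obtain us where
    "w = c @ us \<and> us @ concat wss = x # y # d \<or> w @ us = c \<and> concat wss = us @ x # y # d"
    by (auto simp: append_eq_append_conv2)
  then show ?case
  proof
    assume us: "w = c @ us \<and> us @ concat wss = x # y # d"
    \<comment> \<open>\<open>us\<close> is what is left of the first word after the prefix
      \<open>c\<close>: the word ends before \<open>x\<close>, between \<open>x\<close> and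
      \<open>y\<close>, or after \<open>y\<close>.\<close>
    consider "us = []" | "us = [x]" "concat wss = y # d" | us' where "us = x # y # us'"
      using us by (cases us; cases "tl us") auto
    then show ?case
    proof cases
      case 1
      then show ?thesis using us IH[of "[]"] by simp
    next
      case 2
      then obtain v vss where "wss = v # vss" by (cases wss) auto
      moreover from this have "y \<in> set v" using 2 Cons.prems(2) by (cases v) auto
      ultimately show ?thesis using us 2
        by (intro disjI2 exI[of _ "[]"] exI[of _ w] exI[of _ v] exI[of _ vss]) simp
    qed (use us in auto)
  qed (use IH in blast)
qed simp

text \<open>A decomposition is kept as a list of words, which suits merging of neighbours and
  comparison by list induction; \<open>mem_basis_composite_Ham\<close> translates it into the
  triples of the composite.\<close>

definition irreducible_blocks :: "'a vgraph \<Rightarrow> 'a vertex list list \<Rightarrow> bool" where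
  "irreducible_blocks \<Gamma> wss \<longleftrightarrow> (\<forall>w\<in>set wss. planar \<Gamma> w) \<and>
     successively (\<lambda>v w. \<not> tube \<Gamma> (set v \<union> set w)) wss"

lemma irreducible_blocks_nonempty: "irreducible_blocks \<Gamma> wss \<Longrightarrow> [] \<notin> set wss"
  using planar_nonempty by (auto simp: irreducible_blocks_def)

text \<open>\<open>w\<close> absorbs the leading block as long as their union is a tube, so the word
  in front grows during the induction. When it stops, the remaining list is untouched and still
  irreducible.\<close>

lemma irreducible_blocks_Cons:
  assumes "planar \<Gamma> w" "irreducible_blocks \<Gamma> wss"
  shows "\<exists>vss. irreducible_blocks \<Gamma> vss \<and> concat vss = w @ concat wss"
  using assms
proof (induction wss arbitrary: w)
  case Nil
  then show ?case by (intro exI[of _ "[w]"]) (simp add: irreducible_blocks_def)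
next
  case (Cons v wss)
  have v: "planar \<Gamma> v" and wss: "irreducible_blocks \<Gamma> wss"
    using Cons.prems(2) by (auto simp: irreducible_blocks_def successively_Cons)
  show ?case
  proof (cases "tube \<Gamma> (set w \<union> set v)")
    case True
    then have "planar \<Gamma> (w @ v)" by (rule planar.append[OF Cons.prems(1) v])
    from Cons.IH[OF this wss] show ?thesis by simp
  next
    case False
    then show ?thesis using Cons.prems by (intro exI[of _ "w # v # wss"]) (simp add: irreducible_blocks_def)
  qed
qed

lemma irreducible_blocks_exist:
  assumes "pair_graph \<Gamma>" "set xs \<subseteq> pverts \<Gamma>"
  shows "\<exists>wss. irreducible_blocks \<Gamma> wss \<and> concat wss = xs"
  using assms(2)
proof (induction xs)
  case Nil
  then show ?case by (intro exI[of _ "[]"]) (simp add: irreducible_blocks_def)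
next
  case (Cons x xs)
  then obtain wss where wss: "irreducible_blocks \<Gamma> wss" "concat wss = xs" by auto
  have "planar \<Gamma> [x]" using Cons.prems by (intro planar.single tube_singleton assms(1)) simp
  from irreducible_blocks_Cons[OF this wss(1)] show ?case using wss(2) by simp
qed

text \<open>
  A planar word cannot straddle two consecutive irreducible blocks: the edge that joins its two
  halves would make the union of these blocks a tube.
\<close>

lemma planar_within_block:
  assumes \<Gamma>: "pair_graph \<Gamma>" and wss: "irreducible_blocks \<Gamma> wss" and dist: "distinct (concat wss)"
    and "planar \<Gamma> xs" "concat wss = a @ xs @ b"
  shows "\<exists>w\<in>set wss. set xs \<subseteq> set w"
  using assms(4,5)
proof (induction arbitrary: a b)
  case (single v)
  then have "v \<in> set (concat wss)" by simp
  then show ?case by auto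
next
  case (append xs ys)
  have unique: "v = w" if "v \<in> set wss" "w \<in> set wss" "z \<in> set v" "z \<in> set w" for v w z
    using dist that by (auto simp: distinct_concat_iff)
  \<comment> \<open>The last letter of \<open>xs\<close> and the first letter of \<open>ys\<close>
    are neighbours in the whole word, so the blocks \<open>v\<close> and \<open>w\<close> that
    contain the two halves are equal or consecutive.\<close>
  obtain xs' x where xs: "xs = xs' @ [x]" using planar_nonempty[OF append.hyps(1)] by (metis rev_exhaust)
  obtain y ys' where ys: "ys = y # ys'" using planar_nonempty[OF append.hyps(2)] by (metis list.exhaust)
  obtain v where v: "v \<in> set wss" "set xs \<subseteq> set v" using append.IH(1)[of a "ys @ b"] append.prems by auto
  obtain w where w: "w \<in> set wss" "set ys \<subseteq> set w" using append.IH(2)[of "a @ xs" b] append.prems by auto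
  have "v = w"
  proof (rule ccontr)
    assume "v \<noteq> w"
    then have disj: "set v \<inter> set w = {}" using unique v w by blast
    have "concat wss = (a @ xs') @ x # y # (ys' @ b)" using append.prems xs ys by simp
    from adjacent_in_concat[OF this irreducible_blocks_nonempty[OF wss]]
    consider u where "u \<in> set wss" "x \<in> set u" "y \<in> set u"
      | vss v' w' uss where "wss = vss @ v' # w' # uss" "x \<in> set v'" "y \<in> set w'" by blast
    then show False
    proof cases
      case 1
      then show False using unique[of u v x] unique[of u w y] v w xs ys \<open>v \<noteq> w\<close> by auto
    next
      case 2
      then have "v' = v" "w' = w" using unique[of v' v x] unique[of w' w y] v w xs ys by auto
      then have "\<not> tube \<Gamma> (set v \<union> set w)"
        using wss 2(1) by (auto simp: irreducible_blocks_def successively_append_iff successively_Cons)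
      moreover obtain s t where "s \<in> set xs" "t \<in> set ys" "(s, t) \<in> parcs \<Gamma>"
        using append.hyps(3) tube_Un_iff[OF \<Gamma> planar_tube[OF append.hyps(1)] planar_tube[OF append.hyps(2)]]
          disj v w by blast
      moreover have "tube \<Gamma> (set v)" "tube \<Gamma> (set w)"
        using wss v(1) w(1) by (auto simp: irreducible_blocks_def planar_tube)
      ultimately show False using tube_Un_iff[OF \<Gamma> _ _ disj] v(2) w(2) by blast
    qed
  qed
  then show ?case using v w by auto
qed

text \<open>The first words share the first letter of the concatenation, so refinement both ways
  gives them the same letters. Being distinct words they have the same length, and as prefixes of
  one word they coincide; the argument then repeats on the tails.\<close>

lemma concat_eq_refines_unique:
  assumes "concat wss = concat vss" "distinct (concat wss)" "[] \<notin> set wss" "[] \<notin> set vss"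
    and "\<And>w. w \<in> set wss \<Longrightarrow> \<exists>v\<in>set vss. set w \<subseteq> set v"
    and "\<And>v. v \<in> set vss \<Longrightarrow> \<exists>w\<in>set wss. set v \<subseteq> set w"
  shows "wss = vss"
  using assms
proof (induction wss arbitrary: vss)
  case Nil
  then show ?case by (metis concat.simps(1) concat_eq_Nil_conv list.set_intros(1) neq_Nil_conv)
next
  case (Cons w wss)
  obtain x w' where w: "w = x # w'" using Cons.prems(3) by (cases w) auto
  obtain v vs where vss: "vss = v # vs" using Cons.prems(1) w by (cases vss) auto
  obtain v' where v: "v = x # v'" using Cons.prems(1,4) w vss by (cases v) auto
  have unique_w: "u = u'" if "u \<in> set (w # wss)" "u' \<in> set (w # wss)" "z \<in> set u" "z \<in> set u'" for u u' z
    using Cons.prems(2) that unfolding distinct_concat_iff by blast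
  have unique_v: "u = u'" if "u \<in> set vss" "u' \<in> set vss" "z \<in> set u" "z \<in> set u'" for u u' z
    using Cons.prems(1,2) that unfolding distinct_concat_iff by (metis disjoint_iff distinct_concat_iff)
  have "set w \<subseteq> set v"
  proof -
    obtain u where u: "u \<in> set vss" "set w \<subseteq> set u" using Cons.prems(5)[of w] by auto
    then show ?thesis using unique_v[of u v x] w v vss by auto
  qed
  moreover have "set v \<subseteq> set w"
  proof -
    obtain u where u: "u \<in> set (w # wss)" "set v \<subseteq> set u" using Cons.prems(6)[of v] vss by auto
    then show ?thesis using unique_w[of u w x] w v by auto
  qed
  moreover have "distinct w" using Cons.prems(2) by simp
  moreover have "distinct v" using Cons.prems(1,2) vss by (metis concat.simps(2) distinct_append)
  ultimately have "length w = length v" by (metis distinct_card subset_antisym)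
  then have wv: "w = v" and rest: "concat wss = concat vs" using Cons.prems(1) vss by auto
  have "wss = vs"
  proof (rule Cons.IH[OF rest])
    show "distinct (concat wss)" "[] \<notin> set wss" "[] \<notin> set vs" using Cons.prems(2-4) vss by auto
    \<comment> \<open>A nonempty word of a tail shares no letter with \<open>w\<close>, so the word
      that contains it cannot be \<open>w\<close>; refinement thus stays within the tails.\<close>
    have disj: "set u \<inter> set w = {}" if "u \<in> set wss" for u using Cons.prems(2) that by auto
    have disj': "set u \<inter> set w = {}" if "u \<in> set vs" for u using Cons.prems(1,2) that vss wv rest by auto
    show "\<exists>v\<in>set vs. set u \<subseteq> set v" if "u \<in> set wss" for u
    proof -
      obtain u' where "u' \<in> set vss" "set u \<subseteq> set u'" using Cons.prems(5)[of u] \<open>u \<in> set wss\<close> by auto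
      moreover have "u \<noteq> []" using Cons.prems(3) \<open>u \<in> set wss\<close> by auto
      ultimately have "u' \<in> set vs"
        using disj[OF \<open>u \<in> set wss\<close>] vss wv by (metis Int_absorb2 set_ConsD set_empty)
      then show ?thesis using \<open>set u \<subseteq> set u'\<close> by blast
    qed
    show "\<exists>w\<in>set wss. set u \<subseteq> set w" if "u \<in> set vs" for u
    proof -
      obtain u' where "u' \<in> set (w # wss)" "set u \<subseteq> set u'" using Cons.prems(6)[of u] \<open>u \<in> set vs\<close> vss by auto
      moreover have "u \<noteq> []" using Cons.prems(4) \<open>u \<in> set vs\<close> vss by auto
      ultimately have "u' \<in> set wss"
        using disj'[OF \<open>u \<in> set vs\<close>] by (metis Int_absorb2 set_ConsD set_empty)
      then show ?thesis using \<open>set u \<subseteq> set u'\<close> by blast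
    qed
  qed
  then show ?case using wv vss by simp
qed

text \<open>Each block of one decomposition is a planar factor of the common word, so
  \<open>planar_within_block\<close> puts it inside a block of the other; refinement in both
  directions forces equality.\<close>

lemma irreducible_blocks_unique:
  assumes \<Gamma>: "pair_graph \<Gamma>" and wss: "irreducible_blocks \<Gamma> wss" and vss: "irreducible_blocks \<Gamma> vss"
    and eq: "concat wss = concat vss" and dist: "distinct (concat wss)"
  shows "wss = vss"
proof (rule concat_eq_refines_unique[OF eq dist])
  have within: "\<exists>u\<in>set uss'. set w \<subseteq> set u"
    if uss: "irreducible_blocks \<Gamma> uss" "w \<in> set uss" and uss': "irreducible_blocks \<Gamma> uss'" "distinct (concat uss')"
      and "concat uss = concat uss'" for uss uss' w
  proof -
    obtain xs ys where "uss = xs @ w # ys" using uss(2) by (meson split_list)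
    then have "concat uss' = concat xs @ w @ concat ys" using \<open>concat uss = concat uss'\<close> by simp
    moreover have "planar \<Gamma> w" using uss by (simp add: irreducible_blocks_def)
    ultimately show ?thesis using planar_within_block[OF \<Gamma> uss'] by blast
  qed
  show "\<exists>v\<in>set vss. set w \<subseteq> set v" if "w \<in> set wss" for w
    by (rule within[OF wss that vss]) (use eq dist in simp_all)
  show "\<exists>w\<in>set wss. set v \<subseteq> set w" if "v \<in> set vss" for v
    by (rule within[OF vss that wss]) (use eq dist in simp_all)
qed (rule irreducible_blocks_nonempty, fact wss vss)+

section \<open>The free module on Ham\<close>

lemma Ham_simps:
  "us \<in> basis Ham \<Gamma> \<longleftrightarrow> us \<in> permutations_of_set (pverts \<Gamma>) \<and>
     successively (\<lambda>v w. v \<noteq> w \<and> (v, w) \<notin> parcs \<Gamma>) us"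
  "relabel Ham \<Gamma> f = map f"
proof -
  have "successively (\<lambda>v w. (v, w) \<in> parcs (complement_graph \<Gamma>)) us \<longleftrightarrow>
      successively (\<lambda>v w. v \<noteq> w \<and> (v, w) \<notin> parcs \<Gamma>) us" if "set us = pverts \<Gamma>"
    by (rule successively_cong) (use that in \<open>auto simp: complement_graph_def\<close>)
  then show "us \<in> basis Ham \<Gamma> \<longleftrightarrow> us \<in> permutations_of_set (pverts \<Gamma>) \<and>
     successively (\<lambda>v w. v \<noteq> w \<and> (v, w) \<notin> parcs \<Gamma>) us"
    by (auto simp: Ham_def permutations_of_set_def)
qed (simp add: Ham_def)

lemma relabel_closed_Ham: "relabel_closed Ham"
  unfolding relabel_closed_def
proof (intro allI impI)
  fix \<Gamma> :: "'a vgraph" and f :: "'a vertex \<Rightarrow> 'a vertex" and us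
  assume \<Gamma>: "connected_graph \<Gamma>" and inj: "inj_on f (pverts \<Gamma>)" and us: "us \<in> basis Ham \<Gamma>"
  then have set: "set us = pverts \<Gamma>" by (simp add: Ham_simps permutations_of_set_def)
  have "successively (\<lambda>v w. f v \<noteq> f w \<and> (f v, f w) \<notin> parcs (image_graph f \<Gamma>)) us \<longleftrightarrow>
      successively (\<lambda>v w. v \<noteq> w \<and> (v, w) \<notin> parcs \<Gamma>) us"
    by (rule successively_cong)
      (use set inj image_graph_arc_iff[OF connected_graphD[OF \<Gamma>] inj] in \<open>auto dest: inj_onD simp del: image_graph_simps\<close>)
  then show "relabel Ham \<Gamma> f us \<in> basis Ham (image_graph f \<Gamma>)"
    using us inj by (simp add: Ham_simps map_mem_permutations_of_set successively_map del: image_graph_simps(2))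
qed

text \<open>Dictionary between triples and irreducible decompositions. Two blocks are adjacent in
  the contraction iff they are distinct and their union is a tube, so the Hamiltonian condition says
  that no block merges with its successor.\<close>

lemma mem_basis_composite_Ham:
  assumes "pair_graph \<Gamma>"
  shows "(I, us, w) \<in> basis (composite Ham PlanEq) \<Gamma> \<longleftrightarrow>
    tube_partition \<Gamma> I \<and> set us = block ` I \<and> distinct us \<and> w \<in> extensional I \<and>
    (\<forall>G\<in>I. distinct (w G) \<and> set (w G) = G) \<and> irreducible_blocks \<Gamma> (map (\<lambda>b. w (members b)) us)"
    (is "?L \<longleftrightarrow> ?R")
proof (cases "tube_partition \<Gamma> I \<and> set us = block ` I \<and> distinct us \<and> w \<in> extensional I \<and>
    (\<forall>G\<in>I. distinct (w G) \<and> set (w G) = G)")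
  case True
  then have I: "tube_partition \<Gamma> I" and us: "set us = block ` I" and w: "\<And>G. G \<in> I \<Longrightarrow> set (w G) = G"
    by auto
  note I' = tube_partitionD[OF assms I]
  have "w \<in> (\<Pi>\<^sub>E G\<in>I. basis PlanEq (induced \<Gamma> G)) \<longleftrightarrow> (\<forall>G\<in>I. planar \<Gamma> (w G))"
    using True I'(7) by (auto simp: PiE_iff basis_PlanEq_induced)
  moreover have "successively (\<lambda>v w. v \<noteq> w \<and> (v, w) \<notin> parcs (quotient \<Gamma> I)) us \<longleftrightarrow>
      successively (\<lambda>b c. \<not> tube \<Gamma> (set (w (members b)) \<union> set (w (members c)))) us"
  proof (rule successively_cong)
    fix b c assume "b \<in> set us" "c \<in> set us"
    then obtain G H where GH: "b = block G" "c = block H" "G \<in> I" "H \<in> I" using us by auto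
    \<comment> \<open>Settles the case \<open>b = c\<close>, in which both sides of the equivalence
      are false.\<close>
    moreover have "tube \<Gamma> (G \<union> G)" using I'(5) GH by simp
    ultimately show "(b \<noteq> c \<and> (b, c) \<notin> parcs (quotient \<Gamma> I)) =
        (\<not> tube \<Gamma> (set (w (members b)) \<union> set (w (members c))))"
      using quotient_arc_iff[OF assms I GH(3,4)] w I'(6) by (auto simp: block_inject simp del: quotient_simps)
  qed simp
  ultimately show ?thesis
    using True I'(6) us
    by (auto simp: mem_basis_composite Ham_simps irreducible_blocks_def successively_map permutations_of_set_def)
next
  case False
  have "basis PlanEq (induced \<Gamma> G) \<subseteq> {xs. distinct xs \<and> set xs = G}" for G
    by (auto simp: basis_PlanEq permutations_of_set_def)
  then have "\<not> ?L"
    using False by (fastforce simp: mem_basis_composite Ham_simps permutations_of_set_def PiE_iff)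
  then show ?thesis using False by blast
qed

lemma basis_composite_Ham_subset:
  "t \<in> basis (composite Ham PlanEq) \<Gamma> \<Longrightarrow> t \<in> basis (composite Perm PlanEq) \<Gamma>"
  by (rule basis_composite_mono[of Ham]) (auto simp: Ham_simps)

lemma bij_betw_gamma_Perm:
  assumes \<Gamma>': "connected_graph \<Gamma>"
  shows "bij_betw (gamma Perm \<Gamma>) (basis (composite Ham PlanEq) \<Gamma>) (basis Perm \<Gamma>)"
proof -
  note \<Gamma> = connected_graphD[OF \<Gamma>']
  have into: "gamma Perm \<Gamma> t \<in> basis Perm \<Gamma>" if "t \<in> basis (composite Ham PlanEq) \<Gamma>" for t
    by (rule gamma_closedD[OF gamma_closed_Perm \<Gamma>' basis_composite_Ham_subset[OF that]])
  have "inj_on (gamma Perm \<Gamma>) (basis (composite Ham PlanEq) \<Gamma>)"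
  proof (rule inj_onI)
    fix t t' assume t: "t \<in> basis (composite Ham PlanEq) \<Gamma>" and t': "t' \<in> basis (composite Ham PlanEq) \<Gamma>"
      and eq: "gamma Perm \<Gamma> t = gamma Perm \<Gamma> t'"
    obtain I us w I' us' w' where t_eq: "t = (I, us, w)" "t' = (I', us', w')" by (metis prod_cases3)
    note tH = t[unfolded t_eq mem_basis_composite_Ham[OF \<Gamma>]] and t'H = t'[unfolded t_eq mem_basis_composite_Ham[OF \<Gamma>]]
    have "distinct (concat (map (\<lambda>b. w (members b)) us))"
      using into[OF t] by (simp add: t_eq permutations_of_set_def)
    then have blocks: "map (\<lambda>b. w (members b)) us = map (\<lambda>b. w' (members b)) us'"
      using eq tH t'H by (intro irreducible_blocks_unique[OF \<Gamma>]) (simp_all add: t_eq)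
    \<comment> \<open>The list of words determines the triple: the letters of each word form its
      block, which gives \<open>us\<close>, then \<open>I\<close>, then the values of
      \<open>w\<close> on \<open>I\<close>; outside \<open>I\<close> extensionality fixes
      \<open>w\<close>.\<close>
    have recover: "map (\<lambda>xs. block (set xs)) (map (\<lambda>b. w (members b)) us) = us"
      if "tube_partition \<Gamma> I" "set us = block ` I" "\<forall>G\<in>I. distinct (w G) \<and> set (w G) = G" for I us w
      using that tube_partitionD(6)[OF \<Gamma> that(1)] by (auto intro!: map_idI)
    have "us = map (\<lambda>xs. block (set xs)) (map (\<lambda>b. w (members b)) us)"
      using recover[of I us w] tH by simp
    also have "\<dots> = us'" unfolding blocks using recover[of I' us' w'] t'H by simp
    finally have us: "us = us'" .
    have "I = members ` block ` I" "I' = members ` block ` I'"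
      using tube_partitionD(6)[OF \<Gamma>] tH t'H members_image_block by metis+
    then have "I = I'" using us tH t'H by simp
    moreover have "w = w'"
    proof (rule extensionalityI)
      show "w \<in> extensional I" "w' \<in> extensional I" using tH t'H \<open>I = I'\<close> by auto
      fix G assume "G \<in> I"
      then have "block G \<in> set us" "finite G" using tH tube_partitionD(6)[OF \<Gamma>] by auto
      then show "w G = w' G" using blocks us by auto
    qed
    ultimately show "t = t'" using us t_eq by simp
  qed
  moreover have "basis Perm \<Gamma> \<subseteq> gamma Perm \<Gamma> ` basis (composite Ham PlanEq) \<Gamma>"
  proof
    fix xs assume "xs \<in> basis Perm \<Gamma>"
    then have xs: "distinct xs" "set xs = pverts \<Gamma>" by (auto simp: permutations_of_set_def)
    then obtain wss where wss: "irreducible_blocks \<Gamma> wss" "concat wss = xs"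
      using irreducible_blocks_exist[OF \<Gamma>] by blast
    note ne = irreducible_blocks_nonempty[OF wss(1)]
    \<comment> \<open>The words become the values of \<open>w\<close>: nonempty words that are
      pairwise disjoint are told apart by their letter sets, so \<open>set\<close> can be inverted
      on them.\<close>
    define I where "I = set ` set wss"
    define w where "w = (\<lambda>G\<in>I. the_inv_into (set wss) set G)"
    have dist: "distinct wss" "\<And>v. v \<in> set wss \<Longrightarrow> distinct v"
      "\<And>u v. u \<in> set wss \<Longrightarrow> v \<in> set wss \<Longrightarrow> u \<noteq> v \<Longrightarrow> set u \<inter> set v = {}"
      using xs(1) ne unfolding wss(2)[symmetric] distinct_concat_iff by (auto simp: removeAll_id)
    have "inj_on set (set wss)"
      using dist(3) ne by (intro inj_onI) (metis inf.idem set_empty)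
    then have w: "w (set v) = v" if "v \<in> set wss" for v
      using that by (simp add: w_def I_def the_inv_into_f_f)
    have fin: "\<And>G. G \<in> I \<Longrightarrow> finite G" by (auto simp: I_def)
    have "tube_partition \<Gamma> I"
      using dist(3) ne wss xs(2)
      by (auto simp: planar_tube tube_partition_def partition_on_def I_def disjoint_def irreducible_blocks_def)
    moreover have "distinct (map (\<lambda>v. block (set v)) wss)"
      using dist(1) \<open>inj_on set (set wss)\<close> by (auto simp: distinct_map block_inject inj_on_def)
    moreover have "map (\<lambda>b. w (members b)) (map (\<lambda>v. block (set v)) wss) = wss"
      using w by (auto intro!: map_idI)
    moreover have "\<forall>G\<in>I. distinct (w G) \<and> set (w G) = G" using w dist(2) by (auto simp: I_def)
    ultimately have "(I, map (\<lambda>v. block (set v)) wss, w) \<in> basis (composite Ham PlanEq) \<Gamma>"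
      and "gamma Perm \<Gamma> (I, map (\<lambda>v. block (set v)) wss, w) = xs"
      using wss unfolding mem_basis_composite_Ham[OF \<Gamma>]
      by (auto simp: I_def image_image w_def simp del: map_map)
    then show "xs \<in> gamma Perm \<Gamma> ` basis (composite Ham PlanEq) \<Gamma>" by force
  qed
  ultimately show ?thesis using into by (auto simp: bij_betw_def)
qed

section \<open>Compatibility of substitution with the structure of the free module\<close>

lemma free_right_module_simps [simp]:
  "basis (free_right_module V P) = basis (composite V P)"
  "relabel (free_right_module V P) = relabel (composite V P)"
  "gamma (free_right_module V P) = free_gamma V P"
  by (simp_all add: free_right_module_def)

lemma basis_composite_cong: "basis V = basis V' \<Longrightarrow> basis (composite V P) = basis (composite V' P)"
  by (simp add: composite_def)

text \<open>\<open>Ham\<close> and \<open>Perm\<close> are both relabelled by \<open>map f\<close>,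
  so this is the equivariance of \<open>Perm\<close> restricted to Hamiltonian paths.\<close>

lemma gamma_Perm_relabel:
  assumes "connected_graph \<Gamma>" "inj_on f (pverts \<Gamma>)" "t \<in> basis (composite Ham PlanEq) \<Gamma>"
  shows "gamma Perm (image_graph f \<Gamma>) (relabel (composite Ham PlanEq) \<Gamma> f t) = relabel Perm \<Gamma> f (gamma Perm \<Gamma> t)"
proof -
  have "relabel (composite Ham PlanEq) \<Gamma> f t = relabel (composite Perm PlanEq) \<Gamma> f t"
    by (cases t) (simp add: relabel_composite Ham_simps)
  then show ?thesis
    using module_axiomsD(3)[OF module_axioms_Perm assms(1) basis_composite_Ham_subset[OF assms(3)] assms(2)] by simp
qed

text \<open>\<open>free_gamma\<close> depends on its generators only through their
  \<open>relabel\<close>, which \<open>Ham\<close> shares with \<open>Perm\<close>; so the claim is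
  an instance of associativity in \<open>Perm\<close>.\<close>

lemma gamma_Perm_free_gamma:
  assumes \<Gamma>: "connected_graph \<Gamma>" and t: "(J, s, q) \<in> basis (composite (composite Ham PlanEq) PlanEq) \<Gamma>"
  shows "gamma Perm \<Gamma> (free_gamma Ham PlanEq \<Gamma> (J, s, q)) = gamma Perm \<Gamma> (J, gamma Perm (quotient \<Gamma> J) s, q)"
proof -
  have "free_gamma Ham PlanEq \<Gamma> (J, s, q) = free_gamma Perm PlanEq \<Gamma> (J, s, q)"
    by (cases s) (simp add: free_gamma_def Ham_simps)
  moreover have "(J, s, q) \<in> basis (composite (composite Perm PlanEq) PlanEq) \<Gamma>"
    by (rule basis_composite_mono[OF _ t]) (auto intro: basis_composite_Ham_subset)
  ultimately show ?thesis using module_axiomsD(4)[OF module_axioms_Perm \<Gamma>] by simp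
qed

text \<open>Substitution embeds the free module in \<open>Perm\<close> and respects relabelling and
  \<open>gamma\<close>, so the axioms are transported back along it.\<close>

lemma module_axioms_free: "module_axioms PlanEq (free_right_module Ham PlanEq)"
proof (rule module_axioms_transport[where \<psi> = "gamma Perm", OF module_axioms_Perm relabel_closed_PlanEq
      gamma_closed_PlanEq unit_mem_PlanEq])
  note comp = basis_composite_cong[OF free_right_module_simps(1)]
  show "relabel_closed (free_right_module Ham PlanEq)"
    using relabel_closed_composite[OF relabel_closed_Ham relabel_closed_PlanEq] by (simp add: relabel_closed_def)
  show "gamma_closed PlanEq (free_right_module Ham PlanEq)"
    unfolding gamma_closed_def comp free_right_module_simps
    using free_gamma_closed[OF relabel_closed_Ham gamma_closed_PlanEq] by blast
  fix \<Gamma> :: "'a vgraph" assume \<Gamma>: "connected_graph \<Gamma>"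
  note bij = bij_betw_gamma_Perm[OF \<Gamma>]
  show "inj_on (gamma Perm \<Gamma>) (basis (free_right_module Ham PlanEq) \<Gamma>)"
    using bij by (simp add: bij_betw_def)
  show "gamma Perm \<Gamma> t \<in> basis Perm \<Gamma>" if "t \<in> basis (free_right_module Ham PlanEq) \<Gamma>" for t
    using bij that by (simp only: free_right_module_simps bij_betwE)
  show "gamma Perm (image_graph f \<Gamma>) (relabel (free_right_module Ham PlanEq) \<Gamma> f t)
      = relabel Perm \<Gamma> f (gamma Perm \<Gamma> t)"
    if "inj_on f (pverts \<Gamma>)" "t \<in> basis (free_right_module Ham PlanEq) \<Gamma>" for f t
    using gamma_Perm_relabel[OF \<Gamma>] that by (simp only: free_right_module_simps)
  show "gamma Perm \<Gamma> (gamma (free_right_module Ham PlanEq) \<Gamma> (J, s, q))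
      = gamma Perm \<Gamma> (J, gamma Perm (quotient \<Gamma> J) s, q)"
    if "(J, s, q) \<in> basis (composite (free_right_module Ham PlanEq) PlanEq) \<Gamma>" for J s q
    using gamma_Perm_free_gamma[OF \<Gamma>] that by (simp only: comp free_right_module_simps)
qed

section \<open>Linearization\<close>

lemma lookup_scale: "Poly_Mapping.lookup (scale c u) k = c * Poly_Mapping.lookup u k"
  by (simp add: scale_def map.rep_eq when_def)

lemma scale_single: "scale c (Poly_Mapping.single k a) = Poly_Mapping.single k (c * a)"
  by (rule poly_mapping_eqI) (simp add: lookup_scale lookup_single when_def)

lemma keys_scale_subset: "Poly_Mapping.keys (scale c u) \<subseteq> Poly_Mapping.keys u"
  by (auto simp: in_keys_iff lookup_scale)

text \<open>With a common finite index set, the sums belonging to different vectors can be added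
  termwise.\<close>

lemma linearize_eq_sum:
  assumes "finite S" "Poly_Mapping.keys u \<subseteq> S"
  shows "linearize h u = (\<Sum>b\<in>S. Poly_Mapping.single (h b) (Poly_Mapping.lookup u b))"
proof -
  have "linearize h u = (\<Sum>b\<in>Poly_Mapping.keys u. Poly_Mapping.single (h b) (Poly_Mapping.lookup u b))"
    by (simp add: linearize_def extend_linearly_def scale_single)
  also have "\<dots> = (\<Sum>b\<in>S. Poly_Mapping.single (h b) (Poly_Mapping.lookup u b))"
    using assms by (intro sum.mono_neutral_left) (auto simp: in_keys_iff)
  finally show ?thesis .
qed

lemma linearize_add: "linearize h (u + v) = linearize h u + linearize h v"
proof -
  let ?S = "Poly_Mapping.keys u \<union> Poly_Mapping.keys v"
  have "linearize h w = (\<Sum>b\<in>?S. Poly_Mapping.single (h b) (Poly_Mapping.lookup w b))"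
    if "Poly_Mapping.keys w \<subseteq> ?S" for w :: "_ \<Rightarrow>\<^sub>0 'b"
    using that by (intro linearize_eq_sum) auto
  then show ?thesis
    using keys_add[of u v] by (simp add: lookup_add single_add sum.distrib)
qed

lemma linearize_scale: "linearize h (scale c u) = scale c (linearize h u)"
proof -
  have scale_sum: "scale c (sum g A) = (\<Sum>a\<in>A. scale c (g a))" for A and g :: "'c \<Rightarrow> ('d \<Rightarrow>\<^sub>0 'b)"
    by (rule poly_mapping_eqI) (simp add: lookup_scale lookup_sum sum_distrib_left)
  show ?thesis
    using linearize_eq_sum[OF finite_keys keys_scale_subset, of h c u]
      linearize_eq_sum[OF finite_keys order_refl, of h u]
    by (simp add: scale_sum scale_single lookup_scale)
qed

lemma linearize_single: "linearize h (Poly_Mapping.single b c) = Poly_Mapping.single (h b) c"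
  using linearize_eq_sum[of "{b}" "Poly_Mapping.single b c" h] by (auto split: if_splits)

lemma linearize_sum: "linearize h (sum g A) = (\<Sum>a\<in>A. linearize h (g a))"
proof -
  have "linearize h 0 = 0" by (simp add: linearize_def extend_linearly_def)
  then show ?thesis by (induction A rule: infinite_finite_induct) (simp_all add: linearize_add)
qed

lemma linearize_linearize: "linearize g (linearize h u) = linearize (\<lambda>b. g (h b)) u"
  unfolding linearize_eq_sum[OF finite_keys order_refl, of h u]
    linearize_eq_sum[OF finite_keys order_refl, of "\<lambda>b. g (h b)" u]
  by (simp add: linearize_sum linearize_single)

lemma linearize_cong:
  "u \<in> free_space B \<Longrightarrow> (\<And>b. b \<in> B \<Longrightarrow> h b = g b) \<Longrightarrow> linearize h u = linearize g u"
  unfolding linearize_def extend_linearly_def free_space_def by (auto intro!: sum.cong)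

lemma linearize_ident: "linearize (\<lambda>b. b) u = u"
  using linearize_eq_sum[OF finite_keys order_refl, of "\<lambda>b. b" u]
  by (intro poly_mapping_eqI) (simp add: lookup_sum lookup_single when_def in_keys_iff)

lemma linearize_in_free_space:
  assumes "u \<in> free_space B" "\<And>b. b \<in> B \<Longrightarrow> h b \<in> C"
  shows "linearize h u \<in> free_space C"
proof -
  have "Poly_Mapping.keys (linearize h u)
      \<subseteq> (\<Union>b\<in>Poly_Mapping.keys u. Poly_Mapping.keys (Poly_Mapping.single (h b) (Poly_Mapping.lookup u b)))"
    unfolding linearize_eq_sum[OF finite_keys order_refl, of h u] by (rule keys_sum)
  also have "\<dots> \<subseteq> h ` Poly_Mapping.keys u" by auto
  also have "\<dots> \<subseteq> C" using assms by (auto simp: free_space_def)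
  finally show ?thesis by (simp add: free_space_def)
qed

lemma linear_iso_linearize:
  assumes "bij_betw h B C"
  shows "linear_iso (free_space B) (free_space C) (linearize h)"
proof -
  define g where "g = the_inv_into B h"
  have h: "\<And>b. b \<in> B \<Longrightarrow> h b \<in> C" "\<And>b. b \<in> B \<Longrightarrow> g (h b) = b"
    and g: "\<And>c. c \<in> C \<Longrightarrow> g c \<in> B" "\<And>c. c \<in> C \<Longrightarrow> h (g c) = c"
    using assms bij_betw_the_inv_into[OF assms]
    by (auto simp: g_def bij_betw_def the_inv_into_f_f f_the_inv_into_f)
  have "bij_betw (linearize h) (free_space B) (free_space C)"
  proof (rule bij_betw_byWitness[where f' = "linearize g"])
    show "\<forall>u\<in>free_space B. linearize g (linearize h u) = u"
      by (auto simp: linearize_linearize linearize_ident h(2)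
          dest!: linearize_cong[where h = "\<lambda>b. g (h b)" and g = "\<lambda>b. b"])
    show "\<forall>u\<in>free_space C. linearize h (linearize g u) = u"
      by (auto simp: linearize_linearize linearize_ident g(2)
          dest!: linearize_cong[where h = "\<lambda>b. h (g b)" and g = "\<lambda>b. b"])
  qed (use linearize_in_free_space h g in blast)+
  then show ?thesis by (simp add: linear_iso_def linearize_add linearize_scale)
qed

text \<open>On linearized maps, \<open>compose_morphism\<close> is again the linearization of a map
  of bases. Both sides of each equation are then linearizations, and these agree if the maps agree
  on basis elements.\<close>

lemma right_module_iso_linearize:
  fixes \<chi> :: "'a vgraph \<Rightarrow> 'm \<Rightarrow> 'n"
  assumes "is_right_module P M" "is_right_module P N"
    and bij: "\<And>\<Gamma>. connected_graph \<Gamma> \<Longrightarrow> bij_betw (\<chi> \<Gamma>) (basis M \<Gamma>) (basis N \<Gamma>)"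
    and rel: "\<And>\<Gamma> f x. connected_graph \<Gamma> \<Longrightarrow> inj_on f (pverts \<Gamma>) \<Longrightarrow> x \<in> basis M \<Gamma> \<Longrightarrow>
      \<chi> (image_graph f \<Gamma>) (relabel M \<Gamma> f x) = relabel N \<Gamma> f (\<chi> \<Gamma> x)"
    and gam: "\<And>\<Gamma> I x p. connected_graph \<Gamma> \<Longrightarrow> (I, x, p) \<in> basis (composite M P) \<Gamma> \<Longrightarrow>
      \<chi> \<Gamma> (gamma M \<Gamma> (I, x, p)) = gamma N \<Gamma> (I, \<chi> (quotient \<Gamma> I) x, p)"
  shows "right_module_iso P M N
    (\<lambda>\<Gamma>. linearize (\<chi> \<Gamma>) :: ('m \<Rightarrow>\<^sub>0 'k::field) \<Rightarrow> ('n \<Rightarrow>\<^sub>0 'k))"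
proof -
  have "compose_morphism (\<lambda>\<Gamma>. linearize (\<chi> \<Gamma>) :: ('m \<Rightarrow>\<^sub>0 'k) \<Rightarrow> ('n \<Rightarrow>\<^sub>0 'k)) \<Gamma> z
      = linearize (\<lambda>(I, x, p). (I, \<chi> (quotient \<Gamma> I) x, p)) z"
    for \<Gamma> and z :: "('a, 'm, 'b) composite_elt \<Rightarrow>\<^sub>0 'k"
    unfolding compose_morphism_def linearize_single linearize_def[of "\<lambda>(I, x, p). (I, \<chi> (quotient \<Gamma> I) x, p)"]
    by (simp add: case_prod_unfold)
  then show ?thesis
    unfolding right_module_iso_def
    using assms(1,2) rel gam linear_iso_linearize[OF bij]
    by (auto simp: linearize_linearize intro!: linearize_cong)
qed

theorem theorem3p4p1:
  shows "\<exists>\<phi> :: 'a vgraph \<Rightarrow> ('a vertex list \<Rightarrow>\<^sub>0 'k::field)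
                 \<Rightarrow> (('a, 'a vertex list, 'a vertex list) composite_elt \<Rightarrow>\<^sub>0 'k).
    right_module_iso PlanEq Perm (free_right_module Ham PlanEq) \<phi>"
proof -
  let ?N = "free_right_module Ham PlanEq :: ('a, ('a, 'a vertex list, 'a vertex list) composite_elt, 'a vertex list) right_module"
  \<comment> \<open>The isomorphism starts at \<open>Perm\<close>, so it is the inverse of
    substitution: it cuts an ordering into its irreducible blocks.\<close>
  define \<chi> where "\<chi> \<Gamma> = the_inv_into (basis ?N \<Gamma>) (gamma Perm \<Gamma>)" for \<Gamma> :: "'a vgraph"
  have bij: "bij_betw (gamma Perm \<Gamma>) (basis ?N \<Gamma>) (basis Perm \<Gamma>)" if "connected_graph \<Gamma>" for \<Gamma> :: "'a vgraph"
    using bij_betw_gamma_Perm[OF that] by simp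
  \<comment> \<open>Equations for \<open>\<chi>\<close> are checked by applying
    \<open>gamma Perm\<close>, where they become equivariance and associativity.\<close>
  have \<chi>I: "\<chi> \<Gamma> x = t" if "connected_graph \<Gamma>" "t \<in> basis ?N \<Gamma>" "gamma Perm \<Gamma> t = x" for \<Gamma> x t
    using bij[OF that(1)] that(2,3) by (auto simp: \<chi>_def bij_betw_def the_inv_into_f_f)
  have \<chi>: "\<chi> \<Gamma> x \<in> basis ?N \<Gamma>" "gamma Perm \<Gamma> (\<chi> \<Gamma> x) = x" if "connected_graph \<Gamma>" "x \<in> basis Perm \<Gamma>" for \<Gamma> x
    using bij[OF that(1)] that(2) bij_betw_the_inv_into[OF bij[OF that(1)]]
    by (auto simp: \<chi>_def f_the_inv_into_f_bij_betw bij_betwE)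
  have "right_module_iso PlanEq Perm ?N
    (\<lambda>\<Gamma>. linearize (\<chi> \<Gamma>) :: _ \<Rightarrow> (('a, 'a vertex list, 'a vertex list) composite_elt \<Rightarrow>\<^sub>0 'k))"
  proof (rule right_module_iso_linearize)
    show "is_right_module PlanEq Perm" "is_right_module PlanEq ?N"
      using is_contractad_PlanEq module_axioms_Perm module_axioms_free by (simp_all add: is_right_module_def)
    show "bij_betw (\<chi> \<Gamma>) (basis Perm \<Gamma>) (basis ?N \<Gamma>)" if "connected_graph \<Gamma>" for \<Gamma>
      unfolding \<chi>_def by (rule bij_betw_the_inv_into[OF bij[OF that]])
    fix \<Gamma> :: "'a vgraph" assume \<Gamma>: "connected_graph \<Gamma>"
    show "\<chi> (image_graph f \<Gamma>) (relabel Perm \<Gamma> f x) = relabel ?N \<Gamma> f (\<chi> \<Gamma> x)"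
      if f: "inj_on f (pverts \<Gamma>)" and x: "x \<in> basis Perm \<Gamma>" for f x
    proof (rule \<chi>I[OF connected_graph_image[OF \<Gamma> f]])
      have t: "\<chi> \<Gamma> x \<in> basis (composite Ham PlanEq) \<Gamma>" using \<chi>(1)[OF \<Gamma> x] by simp
      show "relabel ?N \<Gamma> f (\<chi> \<Gamma> x) \<in> basis ?N (image_graph f \<Gamma>)"
        using relabel_closedD[OF relabel_closed_composite[OF relabel_closed_Ham relabel_closed_PlanEq] \<Gamma> f t]
        by simp
      show "gamma Perm (image_graph f \<Gamma>) (relabel ?N \<Gamma> f (\<chi> \<Gamma> x)) = relabel Perm \<Gamma> f x"
        using gamma_Perm_relabel[OF \<Gamma> f t] \<chi>(2)[OF \<Gamma> x] by simp
    qed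
    show "\<chi> \<Gamma> (gamma Perm \<Gamma> (I, x, p)) = gamma ?N \<Gamma> (I, \<chi> (quotient \<Gamma> I) x, p)"
      if t: "(I, x, p) \<in> basis (composite Perm PlanEq) \<Gamma>" for I x p
    proof (rule \<chi>I[OF \<Gamma>])
      have I: "tube_partition \<Gamma> I" and x: "x \<in> basis Perm (quotient \<Gamma> I)"
        using t by (simp_all only: mem_basis_composite)
      note \<Gamma>I = connected_graph_quotient[OF \<Gamma> I]
      have t': "(I, \<chi> (quotient \<Gamma> I) x, p) \<in> basis (composite (composite Ham PlanEq) PlanEq) \<Gamma>"
        using t \<chi>(1)[OF \<Gamma>I x] by (simp add: mem_basis_composite[of I])
      show "gamma ?N \<Gamma> (I, \<chi> (quotient \<Gamma> I) x, p) \<in> basis ?N \<Gamma>"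
        using free_gamma_closed[OF relabel_closed_Ham gamma_closed_PlanEq \<Gamma> t'] by simp
      show "gamma Perm \<Gamma> (gamma ?N \<Gamma> (I, \<chi> (quotient \<Gamma> I) x, p)) = gamma Perm \<Gamma> (I, x, p)"
        using gamma_Perm_free_gamma[OF \<Gamma> t'] \<chi>(2)[OF \<Gamma>I x] by simp
    qed
  qed
  then show ?thesis by blast
qed

end
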